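(* There is a universal constant $C>0$ such that the following holds. Let $n\ge 3$, let $\pi$ be a 3-Monte shuffle on $n$ cards (a random permutation in $S_n$ with a fixed 3-Monte form), let $\pi_1,\pi_2,\dots$ be independent copies of $\pi$ (each with its 3-Monte form), and let $\pi_{(m)}=\pi_1\pi_2\cdots\pi_m$. Fix an integer $t>0$ and let $T$ be a random variable taking values in $\{1,\dots,t\}$ that is independent of the shuffles $\{\pi_i\}$. For distinct cards $x,y,z$ let $T_{xyz}$ be the time of the first 3-collision in the time interval $\{T,\dots,t\}$ that involves at least one of the cards $x,y,z$ (undefined if there is no such collision). If the collision at time $T_{xyz}$ is a collision of $x,y$ and $z$ (that is, $x,y,z$ collide, in this order, at time $T_{xyz}$), say that it matches $x$ with $y$ and $z$, and define $M_1(x)=y$ (the front match of $x$) and $M_2(x)=z$ (the back match of $x$). If no such $y,z$ exist, define $M_1(x)=M_2(x)=x$. Suppose that for every $k$ with $3\le k\le n$ there is a constant $A_k$ with $0\le A_k\le 1$ such that $$\mathbb P\big(M_2(k)=j,\ M_1(k)<k\big)\ \ge\ \frac{A_k}{k}\qquad\text{for each } j\in\{1,\dots,k-1\}.$$ Let $\mu$ be an arbitrary random permutation in $S_n$ that is independent of $\{\pi_i\}$. Then $$\mathbb E\big(\mathrm{ENT}(\mu\pi_{(t)}\mid \mathrm{sgn}(\mu\pi_{(t)}))\big)-\mathbb E\big(\mathrm{ENT}(\mu\mid \mathrm{sgn}(\mu))\big)\ \le\ \frac{-C}{\log n}\sum_{k=3}^{n}A_kE_k,$$ where $E_k=\mathbb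 E\big(\mathrm{ENT}(\mu^{-1}(k)\mid \widetilde{\mathcal T}^{\mu}_{k+1})\big)$.
   Context: Permutations and products. A permutation $\pi\in S_n$ represents the order of a deck: $\pi(i)$ is the position of card $i$. Products are written left to right: $\pi\mu$ denotes the composition $\mu\circ\pi$ (first $\pi$, then $\mu$). Card $x$ is the card initially in position $x$. 3-collisions. For distinct $a,b,c\in\{1,\dots,n\}$, a 3-collision of $a,b,c$, denoted $c(a,b,c)$, is a random permutation equal to the identity with probability $1/2$ and to the 3-cycle $(a,b,c)$ with probability $1/2$. (The order matters only through the 3-cycle, so $c(a,b,c)$, $c(b,c,a)$, $c(c,a,b)$ are the same.) 3-Monte. A random permutation $\pi$ is in 3-Monte form if it is written as $\pi=\nu\, c(x_1,y_1,z_1)\cdots c(x_q,y_q,z_q)$, where $\nu$ is an arbitrary random permutation, the numbers $x_1,\dots,x_q,y_1,\dots,y_q,z_1,\dots,z_q$ are distinct, and $c(x_j,y_j,z_j)$ is a 3-collision of $x_j,y_j,z_j$. The values of the $x_j,y_j,z_j$ and the number $q$ of collisions (possibly $0$) may depend on $\nu$, but conditional on $\nu$ the collisions are independent. A 3-Monte shuffle is a random permutation with a given 3-Monte form. Collisions of cards. Distinct cards $x,y,z$ collide (in this order) at time $m$ if for some $i,j,k$ we have $\pi_{(m)}^{-1}(i)=x$, $\pi_{(m)}^{-1}(j)=y$, $\pi_{(m)}^{-1}(k)=z$ and the 3-Monte form of $\pi_m$ has a 3-collision of $i,j,k$. A collision at time $m$ involves a card if that card is one of the three cards that collide. Relative entropy.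 For a probability distribution $p$ on a finite set $V$, $\mathrm{ENT}(p)=\sum_{i\in V}p_i\log(|V|p_i)$ with $0\log 0=0$. Let $\nu$ be a uniform random permutation in $S_n$. If $g,h$ are functions on $S_n$ such that, for every $x$ in the image of $g$, the conditional law of $h(\nu)$ given $g(\nu)=x$ is uniform on some set, then $\mathrm{ENT}(h(\pi)\mid g(\pi)=x)$ is the relative entropy of the conditional law of $h(\pi)$ given $g(\pi)=x$ with respect to the conditional law of $h(\nu)$ given $g(\nu)=x$. (The case $h=\mathrm{id}$ gives $\mathrm{ENT}(\pi\mid g(\pi)=x)$.) $\mathrm{ENT}(h(\pi)\mid g(\pi))$ is the random variable taking the value $\mathrm{ENT}(h(\pi)\mid g(\pi)=x)$ when $g(\pi)=x$. Tails. For a permutation $\mu$, $\mathcal T^\mu_i=(\mu^{-1}(i),\dots,\mu^{-1}(n))$, $\mathcal T^\mu_{n+1}$ is the empty string, and $\widetilde{\mathcal T}^\mu_i=(\mathcal T^\mu_i,\mathrm{sgn}(\mu))$. *)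

theory Defs
  imports "HOL-Probability.Product_PMF" "HOL-Combinatorics.Combinatorics"
begin

text \<open>
  A permutation of \<open>{1..n}\<close> is a function \<open>\<sigma>\<close> with \<open>\<sigma> permutes {1..n}\<close>; \<open>\<sigma> i\<close> is the position of
  card \<open>i\<close>. Products are read left to right, so the product of \<open>\<sigma>\<close> and \<open>\<tau>\<close> (first \<open>\<sigma>\<close>, then \<open>\<tau>\<close>)
  is \<open>\<tau> \<circ> \<sigma>\<close>. All random objects are discrete and are represented by their laws;
  independent families are represented by product laws.
\<close>

type_synonym perm = "nat \<Rightarrow> nat"
type_synonym triple = "nat \<times> nat \<times> nat"

text \<open>\<open>cycle_of_list [a, b, c]\<close> is the 3-cycle that maps \<open>a\<close> to \<open>b\<close>, \<open>b\<close> to \<open>c\<close> and \<open>c\<close> to \<open>a\<close>.\<close>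

fun collision_pmf :: "triple \<Rightarrow> perm pmf" where
  "collision_pmf (a, b, c) =
     map_pmf (\<lambda>heads. if heads then cycle_of_list [a, b, c] else id) (bernoulli_pmf (1/2))"

primrec collisions_pmf :: "triple list \<Rightarrow> perm pmf" where
  "collisions_pmf [] = return_pmf id"
| "collisions_pmf (xyz # xs) =
     map_pmf (\<lambda>(\<kappa>, \<rho>). \<rho> \<circ> \<kappa>) (pair_pmf (collision_pmf xyz) (collisions_pmf xs))"

text \<open>
  A 3-Monte form is given by the joint law \<open>F\<close> of the permutation \<open>\<nu>\<close> and of the list
  \<open>[(x\<^sub>1, y\<^sub>1, z\<^sub>1), \<dots>, (x\<^sub>q, y\<^sub>q, z\<^sub>q)]\<close> of collision triples, whose length is the number \<open>q\<close> of
  collisions. The list may depend on \<open>\<nu>\<close> in an arbitrary way; in particular it may be a function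
  of \<open>\<nu>\<close>.
\<close>

definition monte3_form :: "nat \<Rightarrow> (perm \<times> triple list) pmf \<Rightarrow> bool" where
  "monte3_form n F \<longleftrightarrow>
     (\<forall>(\<nu>, xs) \<in> set_pmf F. \<nu> permutes {1..n} \<and>
        distinct (concat (map (\<lambda>(x, y, z). [x, y, z]) xs)) \<and>
        set (concat (map (\<lambda>(x, y, z). [x, y, z]) xs)) \<subseteq> {1..n})"

text \<open>
  The joint law of the collision triples and of the shuffle
  \<open>\<pi> = \<nu> c(x\<^sub>1, y\<^sub>1, z\<^sub>1) \<cdots> c(x\<^sub>q, y\<^sub>q, z\<^sub>q)\<close>: given \<open>\<nu>\<close> and the triples, the collisions are independent.
  The triples are kept because the collisions of cards are defined through the form, and not
  through the permutation \<open>\<pi>\<close> alone.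
\<close>

definition monte3_pmf :: "(perm \<times> triple list) pmf \<Rightarrow> (triple list \<times> perm) pmf" where
  "monte3_pmf F =
     bind_pmf F (\<lambda>(\<nu>, xs). map_pmf (\<lambda>\<kappa>. (xs, \<kappa> \<circ> \<nu>)) (collisions_pmf xs))"

text \<open>
  Independent copies of the shuffle at the times \<open>1, \<dots>, t\<close>; an outcome \<open>\<omega>\<close> has the collision
  triples of the form of \<open>\<pi>\<^sub>m\<close> as \<open>fst (\<omega> m)\<close> and the permutation \<open>\<pi>\<^sub>m\<close> as \<open>snd (\<omega> m)\<close>. The values
  outside \<open>{1..t}\<close> are dummies.
\<close>

definition shuffles_pmf ::
    "(perm \<times> triple list) pmf \<Rightarrow> nat \<Rightarrow> (nat \<Rightarrow> triple list \<times> perm) pmf" where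
  "shuffles_pmf F t = Pi_pmf {1..t} ([], id) (\<lambda>_. monte3_pmf F)"

primrec deck :: "(nat \<Rightarrow> triple list \<times> perm) \<Rightarrow> nat \<Rightarrow> perm" where
  "deck \<omega> 0 = id"
| "deck \<omega> (Suc m) = snd (\<omega> (Suc m)) \<circ> deck \<omega> m"

text \<open>The collision of \<open>i, j, k\<close> is the same as that of \<open>j, k, i\<close> and that of \<open>k, i, j\<close>.\<close>

definition has_collision :: "triple list \<Rightarrow> nat \<Rightarrow> nat \<Rightarrow> nat \<Rightarrow> bool" where
  "has_collision xs i j k \<longleftrightarrow> (i, j, k) \<in> set xs \<or> (j, k, i) \<in> set xs \<or> (k, i, j) \<in> set xs"

definition collide ::
    "(nat \<Rightarrow> triple list \<times> perm) \<Rightarrow> nat \<Rightarrow> nat \<Rightarrow> nat \<Rightarrow> nat \<Rightarrow> bool" where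
  "collide \<omega> m x y z \<longleftrightarrow> distinct [x, y, z] \<and>
     (\<exists>i j k. inv (deck \<omega> m) i = x \<and> inv (deck \<omega> m) j = y \<and> inv (deck \<omega> m) k = z \<and>
        has_collision (fst (\<omega> m)) i j k)"

definition involved :: "(nat \<Rightarrow> triple list \<times> perm) \<Rightarrow> nat \<Rightarrow> nat \<Rightarrow> bool" where
  "involved \<omega> m x \<longleftrightarrow> (\<exists>a b c. collide \<omega> m a b c \<and> x \<in> {a, b, c})"

text \<open>
  \<open>first_time \<omega> s t x y z m\<close> says that \<open>T\<^sub>x\<^sub>y\<^sub>z\<close> is defined and equal to \<open>m\<close> if \<open>T\<close> has the value \<open>s\<close>.
\<close>

definition first_time ::
    "(nat \<Rightarrow> triple list \<times> perm) \<Rightarrow> nat \<Rightarrow> nat \<Rightarrow> nat \<Rightarrow> nat \<Rightarrow> nat \<Rightarrow> nat \<Rightarrow> bool" where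
  "first_time \<omega> s t x y z m \<longleftrightarrow>
     m \<in> {s..t} \<and> (\<exists>w\<in>{x, y, z}. involved \<omega> m w) \<and>
     (\<forall>m'\<in>{s..<m}. \<forall>w\<in>{x, y, z}. \<not> involved \<omega> m' w)"

definition matched ::
    "(nat \<Rightarrow> triple list \<times> perm) \<Rightarrow> nat \<Rightarrow> nat \<Rightarrow> nat \<Rightarrow> nat \<Rightarrow> nat \<Rightarrow> bool" where
  "matched \<omega> s t x y z \<longleftrightarrow> (\<exists>m. first_time \<omega> s t x y z m \<and> collide \<omega> m x y z)"

text \<open>
  For a form satisfying \<open>monte3_form\<close>, the pair \<open>y, z\<close> is unique if it exists: \<open>T\<^sub>x\<^sub>y\<^sub>z\<close> is then the
  first time in \<open>{s..t}\<close> at which \<open>x\<close> is involved in a collision, and the triples of one form are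
  disjoint.
\<close>

definition front_match :: "(nat \<Rightarrow> triple list \<times> perm) \<Rightarrow> nat \<Rightarrow> nat \<Rightarrow> nat \<Rightarrow> nat" where
  "front_match \<omega> s t x =
     (if \<exists>y z. matched \<omega> s t x y z then THE y. \<exists>z. matched \<omega> s t x y z else x)"

definition back_match :: "(nat \<Rightarrow> triple list \<times> perm) \<Rightarrow> nat \<Rightarrow> nat \<Rightarrow> nat \<Rightarrow> nat" where
  "back_match \<omega> s t x =
     (if \<exists>y z. matched \<omega> s t x y z then THE z. \<exists>y. matched \<omega> s t x y z else x)"

definition ENT :: "'a set \<Rightarrow> 'a pmf \<Rightarrow> real" where
  "ENT V p = (\<Sum>i\<in>V. pmf p i * ln (real (card V) * pmf p i))"

definition cond_law :: "perm pmf \<Rightarrow> (perm \<Rightarrow> 'b) \<Rightarrow> (perm \<Rightarrow> 'a) \<Rightarrow> 'b \<Rightarrow> 'a pmf" where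
  "cond_law p g h x = map_pmf h (cond_pmf p {\<sigma>. g \<sigma> = x})"

definition uniform_perm :: "nat \<Rightarrow> perm pmf" where
  "uniform_perm n = pmf_of_set {\<sigma>. \<sigma> permutes {1..n}}"

text \<open>
  \<open>cond_ENT n p h g x\<close> is \<open>ENT(h(\<pi>) | g(\<pi>) = x)\<close> for a random permutation \<open>\<pi>\<close> of \<open>{1..n}\<close> with law
  \<open>p\<close>. It is only meant for \<open>g\<close> and \<open>h\<close> such that the conditional law of \<open>h\<close> given \<open>g = x\<close> under a
  uniform permutation is uniform on some set; that set is then the support of this law.
\<close>

definition cond_ENT ::
    "nat \<Rightarrow> perm pmf \<Rightarrow> (perm \<Rightarrow> 'a) \<Rightarrow> (perm \<Rightarrow> 'b) \<Rightarrow> 'b \<Rightarrow> real" where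
  "cond_ENT n p h g x = ENT (set_pmf (cond_law (uniform_perm n) g h x)) (cond_law p g h x)"

definition expected_ENT ::
    "nat \<Rightarrow> perm pmf \<Rightarrow> (perm \<Rightarrow> 'a) \<Rightarrow> (perm \<Rightarrow> 'b) \<Rightarrow> real" where
  "expected_ENT n p h g = measure_pmf.expectation p (\<lambda>\<sigma>. cond_ENT n p h g (g \<sigma>))"

definition tail :: "nat \<Rightarrow> nat \<Rightarrow> perm \<Rightarrow> nat list" where
  "tail n i \<sigma> = map (inv \<sigma>) [i..<Suc n]"

definition signed_tail :: "nat \<Rightarrow> nat \<Rightarrow> perm \<Rightarrow> nat list \<times> int" where
  "signed_tail n i \<sigma> = (tail n i \<sigma>, sign \<sigma>)"

end

theory Submission
  imports Defs
begin

text \<open>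
  Shuffling cannot increase entropy, because entropy is convex; the point is to find coins in the
  shuffle whose randomness certainly decreases it. These are the coins of the matched collisions. From
  the time \<open>T\<close> on, keep the coin of a 3-collision hidden whenever none of its three cards has been in a
  collision since \<open>T\<close>. Whether such a coin shows heads or tails only permutes the three cards
  cyclically, and as all three now count as involved, the coin has no influence on which later
  collisions are matches. Hence, given the hidden triples, the deck at time \<open>t\<close> is a composition of the product of their
  3-collisions, acting first on the cards, and a rest that is independent of the hidden coins; and the
  triples are exactly the matches (\<open>postponed_step\<close>, \<open>postponed_representation\<close>). The rest costs nothing: conditional
  entropy given the sign is convex in the law (\<open>expected_ENT_mixture\<close>) and does not change under
  composition with a fixed permutation (\<open>expected_ENT_compose_perm\<close>).

  It remains to see what a product of disjoint 3-collisions does to \<open>\<mu>\<close>. Rotate a triple to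
  \<open>(k, y, j)\<close> with \<open>k\<close> the largest entry. Its collision replaces a law by the average of
  two laws with the same sign distribution, and the entropy lost is a Jensen--Shannon divergence.
  This divergence shrinks when one looks only at the sign, at the cards in positions above \<open>k\<close>, and at the
  card that ends up in position \<open>k\<close>; heads puts the card from position \<open>j\<close> there. So the loss is at least
  the divergence between the laws of the cards in positions \<open>k\<close> and \<open>j\<close>, given the signed tail: this is
  \<open>exchange_gain n \<mu> k j\<close>. Performing the collisions in increasing order of their largest entry, a
  collision meets a deck in which its three positions, all higher positions and the sign still have the
  joint law that they have under \<open>\<mu>\<close>, and the losses add up (\<open>expected_ENT_collisions\<close>).

  Finally, the match of \<open>k\<close> has back partner \<open>j\<close>, with front partner below \<open>k\<close>, with probability at
  least \<open>A k / k\<close>, so the expected loss at \<open>k\<close> is at least \<open>A k\<close> times the average of the gains over the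
  positions \<open>j \<le> k\<close> (the gain for \<open>j = k\<close> is zero). Divergence is convex, and the laws of the cards in
  positions up to \<open>k\<close> average to the uniform law on the remaining \<open>k\<close> cards. Thus the average gain is
  at least the divergence from the uniform law, which is at least a constant over \<open>log n\<close> times the
  relative entropy (\<open>js_ge_entropy_summand\<close>, \<open>averaged_exchange_gain\<close>).
\<close>

section \<open>Inequalities for entropy summands\<close>

lemma log_sum_inequality:
  fixes a b :: "'i \<Rightarrow> real"
  assumes fin: "finite I" and a: "\<And>i. i \<in> I \<Longrightarrow> 0 \<le> a i" and b: "\<And>i. i \<in> I \<Longrightarrow> 0 \<le> b i"
    and ac: "\<And>i. i \<in> I \<Longrightarrow> b i = 0 \<Longrightarrow> a i = 0"
  shows "sum a I * ln (sum a I / sum b I) \<le> (\<Sum>i\<in>I. a i * ln (a i / b i))"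
proof (cases "sum a I = 0")
  case True
  then have "\<And>i. i \<in> I \<Longrightarrow> a i = 0"
    using a fin by (simp add: sum_nonneg_eq_0_iff)
  then show ?thesis by simp
next
  case False
  define A where "A = sum a I"
  define B where "B = sum b I"
  have A: "A > 0" using False a unfolding A_def by (simp add: less_le sum_nonneg)
  have "B \<noteq> 0"
  proof
    assume "B = 0"
    then have "\<And>i. i \<in> I \<Longrightarrow> b i = 0"
      using b fin unfolding B_def by (simp add: sum_nonneg_eq_0_iff)
    then have "A = 0" using ac unfolding A_def by simp
    then show False using A by simp
  qed
  then have B: "B > 0" using b unfolding B_def by (simp add: less_le sum_nonneg)
  have "a i * ln (A / B) + a i - b i * (A / B) \<le> a i * ln (a i / b i)" if i: "i \<in> I" for i
  proof (cases "a i = 0")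
    case True
    then show ?thesis using b[OF i] A B by simp
  next
    case False
    then have ai: "a i > 0" using a[OF i] by simp
    then have bi: "b i > 0" using ac[OF i] b[OF i] by (cases "b i = 0") auto
    define u where "u = (A / B) * (b i / a i)"
    have u: "u > 0" unfolding u_def using A B ai bi by simp
    have "ln (A / B) = ln u + ln (a i / b i)"
      unfolding u_def using A B ai bi by (simp add: ln_mult ln_div)
    moreover have "a i * ln u \<le> a i * (u - 1)"
      using ln_le_minus_one[OF u] ai by (intro mult_left_mono) auto
    moreover have "a i * (u - 1) = b i * (A / B) - a i"
      unfolding u_def using ai by (simp add: field_simps)
    ultimately show ?thesis by (simp add: algebra_simps)
  qed
  then have "(\<Sum>i\<in>I. a i * ln (A / B) + a i - b i * (A / B)) \<le> (\<Sum>i\<in>I. a i * ln (a i / b i))"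
    by (rule sum_mono)
  moreover have "(\<Sum>i\<in>I. a i * ln (A / B) + a i - b i * (A / B)) = A * ln (A / B) + A - B * (A / B)"
    unfolding A_def B_def by (simp add: sum.distrib sum_subtractf sum_distrib_right del: times_divide_eq_right)
  moreover have "B * (A / B) = A" using B by simp
  ultimately show ?thesis unfolding A_def B_def by linarith
qed

text \<open>
  The contribution of one outcome, with probabilities \<open>x\<close> and \<open>y\<close> under two laws, to the Jensen--Shannon
  divergence of these laws. It is applied to joint probabilities, without normalisation, which spares all
  conditional laws.
\<close>

definition js :: "real \<Rightarrow> real \<Rightarrow> real" where
  "js x y = (x * ln x + y * ln y) / 2 - (x + y) / 2 * ln ((x + y) / 2)"

lemma js_same [simp]: "js x x = 0"
  by (simp add: js_def)

lemma js_relative: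
  assumes "0 \<le> x" "0 \<le> y"
  shows "js x y = (x * ln (x / ((x + y) / 2)) + y * ln (y / ((x + y) / 2))) / 2"
proof -
  define m where "m = (x + y) / 2"
  have "x * ln (x / m) = x * ln x - x * ln m"
  proof (cases "x = 0")
    case False
    then have "ln (x / m) = ln x - ln m" using assms by (subst ln_div) (auto simp: m_def)
    then show ?thesis by (simp add: right_diff_distrib)
  qed simp
  moreover have "y * ln (y / m) = y * ln y - y * ln m"
  proof (cases "y = 0")
    case False
    then have "ln (y / m) = ln y - ln m" using assms by (subst ln_div) (auto simp: m_def)
    then show ?thesis by (simp add: right_diff_distrib)
  qed simp
  ultimately have "(x * ln (x / m) + y * ln (y / m)) / 2 = (x * ln x + y * ln y) / 2 - m * ln m"
    by (simp add: m_def field_simps)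
  then show ?thesis by (simp add: js_def m_def)
qed

lemma js_scale:
  assumes "0 < c" "0 \<le> x" "0 \<le> y"
  shows "js (c * x) (c * y) = c * js x y"
proof -
  have "js (c * x) (c * y) =
      (c * x * ln (x / ((x + y) / 2)) + c * y * ln (y / ((x + y) / 2))) / 2"
  proof -
    have "(c * x + c * y) / 2 = c * ((x + y) / 2)" by (simp add: algebra_simps)
    then show ?thesis
      using assms by (subst js_relative) (simp_all only: mult_divide_mult_cancel_left_if mult_nonneg_nonneg less_imp_le split: if_split, auto)
  qed
  then show ?thesis using assms by (simp add: js_relative algebra_simps)
qed

text \<open>
  The function \<open>js\<close> is convex and homogeneous, hence subadditive. This one fact serves both as the data
  processing inequality and as the convexity that allows averaging over positions.
\<close>

lemma js_sum_le:
  assumes fin: "finite I" and x: "\<And>i. i \<in> I \<Longrightarrow> 0 \<le> x i" and y: "\<And>i. i \<in> I \<Longrightarrow> 0 \<le> y i"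
  shows "js (sum x I) (sum y I) \<le> (\<Sum>i\<in>I. js (x i) (y i))"
proof -
  define m where "m i = (x i + y i) / 2" for i
  have m: "sum m I = (sum x I + sum y I) / 2"
    by (simp add: m_def sum.distrib flip: sum_divide_distrib)
  have "sum x I * ln (sum x I / sum m I) \<le> (\<Sum>i\<in>I. x i * ln (x i / m i))"
    by (rule log_sum_inequality) (use fin x y in \<open>force simp: m_def\<close>)+
  moreover have "sum y I * ln (sum y I / sum m I) \<le> (\<Sum>i\<in>I. y i * ln (y i / m i))"
    by (rule log_sum_inequality) (use fin x y in \<open>force simp: m_def\<close>)+
  moreover have "js (sum x I) (sum y I) =
      (sum x I * ln (sum x I / sum m I) + sum y I * ln (sum y I / sum m I)) / 2"
    unfolding m by (rule js_relative) (auto intro: sum_nonneg x y)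
  moreover have "(\<Sum>i\<in>I. js (x i) (y i)) =
      ((\<Sum>i\<in>I. x i * ln (x i / m i)) + (\<Sum>i\<in>I. y i * ln (y i / m i))) / 2"
    by (simp add: js_relative x y m_def sum.distrib flip: sum_divide_distrib)
  ultimately show ?thesis by (simp add: divide_right_mono add_mono)
qed

text \<open>
  The quadratic term comes from the Hellinger distance: \<open>ln u = 2 ln (sqrt u) \<ge> 2 (1 - 1 / sqrt u)\<close> gives
  \<open>u ln u - u + 1 \<ge> (sqrt u - 1)\<^sup>2 = (u - 1)\<^sup>2 / (sqrt u + 1)\<^sup>2\<close>, and the last denominator is at most
  \<open>6\<close> for \<open>u \<le> 2\<close>.
\<close>

lemma entropy_summand_lower_bound:
  fixes x m :: real
  assumes "0 \<le> x" "0 < m" "x \<le> 2 * m"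
  shows "x * ln (x / m) \<ge> x - m + (x - m)\<^sup>2 / (6 * m)"
proof -
  have *: "u * ln u \<ge> u - 1 + (u - 1)\<^sup>2 / 6" if u: "0 \<le> u" "u \<le> 2" for u :: real
  proof (cases "u = 0")
    case False
    define v where "v = sqrt u"
    have v: "v > 0" "u = v\<^sup>2" using u False by (auto simp: v_def)
    have "ln (1 / v) \<le> 1 / v - 1" using v by (intro ln_le_minus_one) auto
    then have "ln v \<ge> 1 - 1 / v" using v by (simp add: ln_div)
    moreover have "ln u = 2 * ln v" using v by (simp add: ln_realpow)
    ultimately have "u * ln u \<ge> u * (2 * (1 - 1 / v))"
      using u by (intro mult_left_mono) auto
    also have "u * (2 * (1 - 1 / v)) = 2 * u - 2 * v"
      using v by (simp add: power2_eq_square field_simps)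
    also have "\<dots> = u - 1 + (v - 1)\<^sup>2" using v by (simp add: power2_eq_square algebra_simps)
    finally have *: "u * ln u \<ge> u - 1 + (v - 1)\<^sup>2" .
    \<comment> \<open>The number \<open>36 / 25\<close> is an upper bound for \<open>sqrt 2\<close> with \<open>(36 / 25 + 1)\<^sup>2 \<le> 6\<close>.\<close>
    have "v\<^sup>2 \<le> (36 / 25)\<^sup>2" using u v by (simp add: power2_eq_square)
    then have "v \<le> 36 / 25" by (rule power2_le_imp_le) simp
    then have "(v + 1)\<^sup>2 \<le> (36 / 25 + 1)\<^sup>2" using v by (intro power_mono) auto
    then have "(v + 1)\<^sup>2 \<le> 6" by (simp add: power2_eq_square)
    then have "(v - 1)\<^sup>2 * (v + 1)\<^sup>2 \<le> (v - 1)\<^sup>2 * 6" by (intro mult_left_mono) auto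
    moreover have "(v - 1)\<^sup>2 * (v + 1)\<^sup>2 = (u - 1)\<^sup>2"
      unfolding v(2) by (simp add: power2_eq_square algebra_simps)
    ultimately show ?thesis using * by simp
  qed simp
  define u where "u = x / m"
  have u: "0 \<le> u" "u \<le> 2" "x = u * m" using assms by (auto simp: u_def field_simps)
  have "m * (u * ln u) \<ge> m * (u - 1 + (u - 1)\<^sup>2 / 6)"
    using *[OF u(1,2)] assms by (intro mult_left_mono) auto
  moreover have "m * (u - 1 + (u - 1)\<^sup>2 / 6) = x - m + (x - m)\<^sup>2 / (6 * m)"
    unfolding u(3) using assms by (simp add: power2_eq_square field_simps)
  ultimately show ?thesis using assms by (simp add: u(3) mult_ac)
qed

text \<open>
  Compare both \<open>x\<close> and \<open>y\<close> with their mean: the linear terms of the two lower bounds cancel.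
\<close>

lemma js_ge_triangular:
  assumes "0 \<le> x" "0 \<le> y"
  shows "js x y \<ge> (x - y)\<^sup>2 / (12 * (x + y))"
proof (cases "x + y = 0")
  case True
  then have "x = 0" "y = 0" using assms by auto
  then show ?thesis by simp
next
  case False
  define m where "m = (x + y) / 2"
  define a b where "a = (x - m)\<^sup>2 / (6 * m)" and "b = (y - m)\<^sup>2 / (6 * m)"
  define u v where "u = x * ln (x / m)" and "v = y * ln (y / m)"
  have m: "m > 0" using False assms by (simp add: m_def)
  have "u \<ge> x - m + a" "v \<ge> y - m + b"
    unfolding u_def v_def a_def b_def
    by (rule entropy_summand_lower_bound; use assms m in \<open>simp add: m_def\<close>)+
  moreover have "a + b = 2 * ((x - y)\<^sup>2 / (12 * (x + y)))"
  proof -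
    have "x - m = (x - y) / 2" "y - m = - ((x - y) / 2)" "6 * m = 3 * (x + y)"
      by (auto simp: m_def field_simps)
    then show ?thesis using False unfolding a_def b_def
      by (simp only: power2_minus) (simp add: power_divide field_simps)
  qed
  moreover have "x - m + (y - m) = 0" by (simp add: m_def)
  moreover have "js x y = (u + v) / 2"
    unfolding m_def u_def v_def using assms by (rule js_relative)
  ultimately show ?thesis by argo
qed

lemma js_nonneg: "0 \<le> x \<Longrightarrow> 0 \<le> y \<Longrightarrow> 0 \<le> js x y"
  using js_ge_triangular[of x y] by (smt (verit) divide_nonneg_nonneg zero_le_power2)

text \<open>
  This is where the logarithm is lost. The right-hand side is, up to the factor, the contribution of an
  outcome to the relative entropy of the first law with respect to the second. Both sides are quadratic in \<open>x - y\<close> as long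
  as \<open>x\<close> is at most a multiple of \<open>y\<close>. For larger \<open>x\<close> the left-hand side is only linear in \<open>x\<close>, while
  the entropy is about \<open>x ln (x / y)\<close>, and the bound \<open>x \<le> n y\<close> limits the ratio to \<open>ln n\<close>.
\<close>

lemma js_ge_entropy_summand:
  fixes n :: nat
  assumes n: "n \<ge> 3" and xy: "0 \<le> x" "0 \<le> y" "x \<le> real n * y"
  shows "js x y \<ge> 1 / (48 * ln (real n)) * (x * ln (x / y) - x + y)"
proof (cases "y = 0")
  case True
  then show ?thesis using xy by simp
next
  case False
  then have y: "y > 0" using xy by simp
  have "exp 1 \<le> real n" using exp_le n by linarith
  then have ln1: "1 \<le> ln (real n)" using n by (simp add: ln_ge_iff)
  note tri = js_ge_triangular[OF xy(1,2)]
  have up: "x * ln (x / y) - x + y \<le> (x - y)\<^sup>2 / y"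
  proof (cases "x = 0")
    case True
    then show ?thesis using y by (simp add: power2_eq_square)
  next
    case False
    then have "x * ln (x / y) \<le> x * (x / y - 1)"
      using xy y by (intro mult_left_mono ln_le_minus_one) auto
    also have "\<dots> = (x - y)\<^sup>2 / y + x - y" using y by (simp add: power2_eq_square field_simps)
    finally show ?thesis by simp
  qed
  show ?thesis
  proof (cases "x \<le> 3 * y")
    case True
    have "(x - y)\<^sup>2 / (48 * y) \<le> (x - y)\<^sup>2 / (12 * (x + y))"
      using True y xy by (intro divide_left_mono) auto
    then have "48 * js x y \<ge> (x - y)\<^sup>2 / y" using tri by simp
    also have "(x - y)\<^sup>2 / y \<ge> (x - y)\<^sup>2 / y / ln (real n)"
      using divide_left_mono[of 1 "ln (real n)" "(x - y)\<^sup>2 / y"] ln1 y by simp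
    also have "(x - y)\<^sup>2 / y / ln (real n) \<ge> (x * ln (x / y) - x + y) / ln (real n)"
      using up ln1 by (intro divide_right_mono) auto
    finally have "(x * ln (x / y) - x + y) / ln (real n) \<le> 48 * js x y" .
    moreover have "1 / (48 * ln (real n)) * z \<le> w" if "z / ln (real n) \<le> 48 * w" for z w
      using that by simp
    ultimately show ?thesis by blast
  next
    case False
    then have x: "x > 3 * y" "x > 0" using y by auto
    have "(2 * x / 3)\<^sup>2 \<le> (x - y)\<^sup>2" using x by (intro power_mono) auto
    then have "(2 * x / 3)\<^sup>2 / (12 * (4 * x / 3)) \<le> (x - y)\<^sup>2 / (12 * (x + y))"
      using x y by (intro frac_le) auto
    moreover have "(2 * x / 3)\<^sup>2 / (12 * (4 * x / 3)) = x / 36"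
      using x by (simp add: power2_eq_square field_simps)
    ultimately have js: "js x y \<ge> x / 36" using tri by linarith
    have "ln (x / y) \<le> ln (real n)" using x y xy n by (simp add: divide_le_eq)
    then have "x * ln (x / y) \<le> x * ln (real n)" using x by (intro mult_left_mono) auto
    then have "x * ln (x / y) - x + y \<le> x * ln (real n)" using x y by linarith
    then have "(x * ln (x / y) - x + y) / ln (real n) \<le> x"
      using ln1 by (simp add: divide_le_eq)
    then have "(x * ln (x / y) - x + y) / ln (real n) \<le> 48 * js x y" using js x by linarith
    moreover have "1 / (48 * ln (real n)) * z \<le> w" if "z / ln (real n) \<le> 48 * w" for z w
      using that by simp
    ultimately show ?thesis by blast
  qed
qed

section \<open>Conditional entropy of a random permutation\<close>

definition perms :: "nat \<Rightarrow> perm set" where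
  "perms n = {\<sigma>. \<sigma> permutes {1..n}}"

lemma perms_iff: "\<sigma> \<in> perms n \<longleftrightarrow> \<sigma> permutes {1..n}"
  by (simp add: perms_def)

lemma finite_perms [simp]: "finite (perms n)"
  unfolding perms_def by (rule finite_permutations) simp

lemma id_perms: "id \<in> perms n"
  by (simp only: perms_iff permutes_id)

lemma compose_perms: "D \<in> perms n \<Longrightarrow> \<sigma> \<in> perms n \<Longrightarrow> D \<circ> \<sigma> \<in> perms n"
  by (simp only: perms_iff permutes_compose)

lemma inv_perms: "\<sigma> \<in> perms n \<Longrightarrow> inv \<sigma> \<in> perms n"
  by (simp only: perms_iff permutes_inv)

lemma sum_pmf_perms_eq_prob:
  assumes "set_pmf p \<subseteq> perms n"
  shows "(\<Sum>\<sigma> | \<sigma> \<in> perms n \<and> Q \<sigma>. pmf p \<sigma>) = measure_pmf.prob p {\<sigma>. Q \<sigma>}"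
proof -
  have "measure_pmf.prob p {\<sigma>. Q \<sigma>} = measure_pmf.prob p {\<sigma> \<in> perms n. Q \<sigma>}"
    using assms by (intro measure_prob_cong_0) (auto simp: set_pmf_eq)
  also have "\<dots> = (\<Sum>\<sigma> | \<sigma> \<in> perms n \<and> Q \<sigma>. pmf p \<sigma>)"
    by (simp add: measure_measure_pmf_finite)
  finally show ?thesis by simp
qed

lemma prob_perms:
  assumes "set_pmf p \<subseteq> perms n"
  shows "measure_pmf.prob p {\<sigma>. Q \<sigma>} = measure_pmf.prob p {\<sigma> \<in> perms n. Q \<sigma>}"
  using assms by (intro measure_prob_cong_0) (auto simp: set_pmf_eq)

lemma expectation_perms:
  fixes f :: "perm \<Rightarrow> real"
  assumes "set_pmf p \<subseteq> perms n"
  shows "measure_pmf.expectation p f = (\<Sum>\<sigma>\<in>perms n. pmf p \<sigma> * f \<sigma>)"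
  using assms by (subst integral_measure_pmf_real[of "perms n"]) (auto simp: mult.commute)

lemma sum_group_perms:
  fixes f :: "'b \<Rightarrow> real"
  shows "(\<Sum>\<sigma> | \<sigma> \<in> perms n \<and> Q \<sigma>. w \<sigma> * f (g \<sigma>)) =
    (\<Sum>x\<in>g ` {\<sigma> \<in> perms n. Q \<sigma>}. (\<Sum>\<sigma> | \<sigma> \<in> perms n \<and> Q \<sigma> \<and> g \<sigma> = x. w \<sigma>) * f x)"
proof -
  have "(\<Sum>\<sigma> | \<sigma> \<in> perms n \<and> Q \<sigma>. w \<sigma> * f (g \<sigma>)) =
      (\<Sum>x\<in>g ` {\<sigma> \<in> perms n. Q \<sigma>}. \<Sum>\<sigma> | \<sigma> \<in> {\<sigma> \<in> perms n. Q \<sigma>} \<and> g \<sigma> = x. w \<sigma> * f (g \<sigma>))"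
    by (rule sum.image_gen) simp
  then show ?thesis by (simp add: sum_distrib_right conj_assoc cong: conj_cong)
qed

lemma set_uniform_perm [simp]: "set_pmf (uniform_perm n) = perms n"
  unfolding uniform_perm_def perms_def[symmetric]
  using id_perms by (intro set_pmf_of_set finite_perms) blast

lemma set_cond_law_uniform:
  assumes "\<sigma> \<in> perms n" "g \<sigma> = x"
  shows "set_pmf (cond_law (uniform_perm n) g h x) = h ` {\<sigma> \<in> perms n. g \<sigma> = x}"
proof -
  have "set_pmf (uniform_perm n) \<inter> {\<sigma>. g \<sigma> = x} \<noteq> {}" using assms by auto
  then show ?thesis by (auto simp: cond_law_def set_cond_pmf)
qed

lemma pmf_cond_law:
  assumes p: "set_pmf p \<subseteq> perms n" and "\<sigma> \<in> set_pmf p" "g \<sigma> = x"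
  shows "pmf (cond_law p g h x) a =
    measure_pmf.prob p {\<sigma>. h \<sigma> = a \<and> g \<sigma> = x} / measure_pmf.prob p {\<sigma>. g \<sigma> = x}"
proof -
  let ?c = "cond_pmf p {\<sigma>. g \<sigma> = x}"
  have ne: "set_pmf p \<inter> {\<sigma>. g \<sigma> = x} \<noteq> {}" using assms by auto
  then have c: "set_pmf ?c \<subseteq> perms n" using p by auto
  have "pmf (cond_law p g h x) a = measure_pmf.prob ?c {\<sigma>. h \<sigma> = a}"
    by (simp add: cond_law_def pmf_map vimage_def)
  also have "\<dots> = (\<Sum>\<sigma> | \<sigma> \<in> perms n \<and> h \<sigma> = a. pmf ?c \<sigma>)"
    by (rule sum_pmf_perms_eq_prob[OF c, symmetric])
  also have "\<dots> = (\<Sum>\<sigma> | \<sigma> \<in> perms n \<and> h \<sigma> = a \<and> g \<sigma> = x.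
      pmf p \<sigma> / measure_pmf.prob p {\<sigma>. g \<sigma> = x})"
    by (rule sum.mono_neutral_cong_right) (auto simp: pmf_cond[OF ne])
  finally show ?thesis by (simp add: sum_pmf_perms_eq_prob[OF p] flip: sum_divide_distrib)
qed

text \<open>
  Multiplying \<open>ENT(h | g = x)\<close> by the probability of \<open>g = x\<close> cancels the normalisation of the conditional
  law, so that the expected conditional entropy becomes the expectation of a log-likelihood ratio.
\<close>

lemma expected_ENT_eq:
  assumes p: "set_pmf p \<subseteq> perms n"
  shows "expected_ENT n p h g = (\<Sum>\<sigma>\<in>perms n. pmf p \<sigma> *
    ln (real (card (h ` {\<tau> \<in> perms n. g \<tau> = g \<sigma>})) *
      (measure_pmf.prob p {\<tau>. h \<tau> = h \<sigma> \<and> g \<tau> = g \<sigma>} / measure_pmf.prob p {\<tau>. g \<tau> = g \<sigma>})))"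
proof -
  define P where "P x = measure_pmf.prob p {\<tau>. g \<tau> = x}" for x
  define R where "R a x = measure_pmf.prob p {\<tau>. h \<tau> = a \<and> g \<tau> = x}" for a x
  define V where "V x = h ` {\<tau> \<in> perms n. g \<tau> = x}" for x
  define F where "F x a = ln (real (card (V x)) * (R a x / P x))" for x a
  have ent: "P x * cond_ENT n p h g x = (\<Sum>\<sigma> | \<sigma> \<in> perms n \<and> g \<sigma> = x. pmf p \<sigma> * F x (h \<sigma>))"
    for x
  proof (cases "\<exists>\<sigma>\<in>set_pmf p. g \<sigma> = x")
    case True
    then obtain \<sigma> where \<sigma>: "\<sigma> \<in> set_pmf p" "g \<sigma> = x" by auto
    then have "P x > 0" unfolding P_def by (intro measure_pmf_posI) auto
    moreover have "cond_ENT n p h g x = (\<Sum>a\<in>V x. R a x / P x * F x a)"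
      using \<sigma> p unfolding cond_ENT_def ENT_def F_def V_def R_def P_def
      by (subst (1 2) set_cond_law_uniform[of \<sigma>]) (auto simp: pmf_cond_law[OF p])
    ultimately have "P x * cond_ENT n p h g x = (\<Sum>a\<in>V x. R a x * F x a)"
      by (simp add: sum_distrib_left)
    also have "\<dots> = (\<Sum>\<sigma> | \<sigma> \<in> perms n \<and> g \<sigma> = x. pmf p \<sigma> * F x (h \<sigma>))"
      using sum_group_perms[where n = n and Q = "\<lambda>\<sigma>. g \<sigma> = x" and w = "pmf p" and f = "F x" and g = h]
      by (simp add: V_def R_def sum_pmf_perms_eq_prob[OF p] conj_commute)
    finally show ?thesis .
  next
    case False
    then have z: "pmf p \<sigma> = 0" if "g \<sigma> = x" for \<sigma> using that by (auto simp: set_pmf_eq)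
    then have "P x = 0"
      using sum_pmf_perms_eq_prob[OF p, of "\<lambda>\<sigma>. g \<sigma> = x"] by (simp add: P_def)
    then show ?thesis using z by simp
  qed
  have "expected_ENT n p h g = (\<Sum>\<sigma> | \<sigma> \<in> perms n \<and> True. pmf p \<sigma> * cond_ENT n p h g (g \<sigma>))"
    unfolding expected_ENT_def by (simp add: expectation_perms[OF p])
  also have "\<dots> = (\<Sum>x\<in>g ` perms n. P x * cond_ENT n p h g x)"
    using sum_group_perms[where n = n and Q = "\<lambda>_. True" and w = "pmf p" and g = g
        and f = "cond_ENT n p h g"]
    by (simp add: P_def sum_pmf_perms_eq_prob[OF p])
  also have "\<dots> = (\<Sum>x\<in>g ` perms n. \<Sum>\<sigma> | \<sigma> \<in> perms n \<and> g \<sigma> = x. pmf p \<sigma> * F (g \<sigma>) (h \<sigma>))"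
    unfolding ent by (intro sum.cong) auto
  also have "\<dots> = (\<Sum>\<sigma>\<in>perms n. pmf p \<sigma> * F (g \<sigma>) (h \<sigma>))"
    by (rule sum.image_gen[symmetric]) simp
  finally show ?thesis unfolding F_def V_def R_def P_def .
qed

lemma expected_ENT_id_eq:
  assumes p: "set_pmf p \<subseteq> perms n"
  shows "expected_ENT n p id g = (\<Sum>\<sigma>\<in>perms n. pmf p \<sigma> *
    ln (real (card {\<tau> \<in> perms n. g \<tau> = g \<sigma>}) * (pmf p \<sigma> / pmf (map_pmf g p) (g \<sigma>))))"
proof -
  have "{\<tau>. id \<tau> = id \<sigma> \<and> g \<tau> = g \<sigma>} = {\<sigma>}" for \<sigma> :: perm by auto
  then show ?thesis
    unfolding expected_ENT_eq[OF p] by (simp add: measure_pmf_single pmf_map vimage_def)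
qed

lemma pmf_le_pmf_map: "pmf p \<sigma> \<le> pmf (map_pmf g p) (g \<sigma>)"
  unfolding pmf_map measure_pmf_single[of p, symmetric]
  by (intro measure_pmf.finite_measure_mono) auto

lemma sum_perms_function_of:
  assumes p: "set_pmf p \<subseteq> perms n"
  shows "(\<Sum>\<sigma>\<in>perms n. pmf p \<sigma> * f (g \<sigma>)) = (\<Sum>x\<in>g ` perms n. pmf (map_pmf g p) x * f x)"
  using sum_group_perms[where Q = "\<lambda>_. True" and n = n and w = "pmf p" and g = g and f = f]
  by (simp add: pmf_map vimage_def flip: sum_pmf_perms_eq_prob[OF p])

text \<open>
  Under \<open>p\<close>, the expected log-likelihood ratio is largest when it is computed from \<open>p\<close> itself. Here the
  ratio is the conditional one given \<open>g\<close>.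
\<close>

lemma gibbs_inequality_conditional:
  assumes p: "set_pmf p \<subseteq> set_pmf q" and q: "set_pmf q \<subseteq> perms n"
  shows "(\<Sum>\<sigma>\<in>perms n. pmf p \<sigma> *
      ln (real (card {\<tau> \<in> perms n. g \<tau> = g \<sigma>}) * (pmf q \<sigma> / pmf (map_pmf g q) (g \<sigma>))))
    \<le> expected_ENT n p id g"
proof -
  have p': "set_pmf p \<subseteq> perms n" using p q by auto
  define N where "N x = real (card {\<tau> \<in> perms n. g \<tau> = x})" for x
  define P where "P = pmf (map_pmf g p)"
  define Q where "Q = pmf (map_pmf g q)"
  have "pmf p \<sigma> * ln (N (g \<sigma>) * (pmf q \<sigma> / Q (g \<sigma>)))
     \<le> pmf p \<sigma> * ln (N (g \<sigma>) * (pmf p \<sigma> / P (g \<sigma>))) + (pmf q \<sigma> * (P (g \<sigma>) / Q (g \<sigma>)) - pmf p \<sigma>)"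
    if \<sigma>: "\<sigma> \<in> perms n" for \<sigma>
  proof (cases "pmf p \<sigma> = 0")
    case True
    then show ?thesis by (simp add: P_def Q_def)
  next
    case False
    then have pp: "pmf p \<sigma> > 0" by (simp add: less_le)
    have qq: "pmf q \<sigma> > 0" using p False by (auto simp: pmf_positive_iff set_pmf_iff)
    have PP: "P (g \<sigma>) > 0" using pp pmf_le_pmf_map[of p \<sigma> g] by (simp add: P_def)
    have QQ: "Q (g \<sigma>) > 0" using qq pmf_le_pmf_map[of q \<sigma> g] by (simp add: Q_def)
    have "\<sigma> \<in> {\<tau> \<in> perms n. g \<tau> = g \<sigma>}" using \<sigma> by simp
    then have "card {\<tau> \<in> perms n. g \<tau> = g \<sigma>} > 0" by (intro card_gt_0_iff[THEN iffD2]) auto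
    then have NN: "N (g \<sigma>) > 0" by (simp add: N_def)
    define u where "u = pmf q \<sigma> * (P (g \<sigma>) / Q (g \<sigma>)) / pmf p \<sigma>"
    have u: "u > 0" unfolding u_def using pp qq PP QQ by simp
    have "N (g \<sigma>) * (pmf q \<sigma> / Q (g \<sigma>)) = u * (N (g \<sigma>) * (pmf p \<sigma> / P (g \<sigma>)))"
      unfolding u_def using pp PP by simp
    then have "ln (N (g \<sigma>) * (pmf q \<sigma> / Q (g \<sigma>))) = ln u + ln (N (g \<sigma>) * (pmf p \<sigma> / P (g \<sigma>)))"
      using u NN pp PP by (simp only:) (intro ln_mult_pos, auto)
    moreover have "pmf p \<sigma> * ln u \<le> pmf p \<sigma> * (u - 1)"
      using ln_le_minus_one[OF u] by (intro mult_left_mono) auto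
    moreover have "pmf p \<sigma> * (u - 1) = pmf q \<sigma> * (P (g \<sigma>) / Q (g \<sigma>)) - pmf p \<sigma>"
      using pp by (simp add: u_def right_diff_distrib)
    ultimately show ?thesis by (simp add: distrib_left)
  qed
  then have "(\<Sum>\<sigma>\<in>perms n. pmf p \<sigma> * ln (N (g \<sigma>) * (pmf q \<sigma> / Q (g \<sigma>)))) \<le>
     (\<Sum>\<sigma>\<in>perms n. pmf p \<sigma> * ln (N (g \<sigma>) * (pmf p \<sigma> / P (g \<sigma>))) +
        (pmf q \<sigma> * (P (g \<sigma>) / Q (g \<sigma>)) - pmf p \<sigma>))"
    by (rule sum_mono)
  also have "\<dots> = expected_ENT n p id g +
      ((\<Sum>x\<in>g ` perms n. Q x * (P x / Q x)) - (\<Sum>\<sigma>\<in>perms n. pmf p \<sigma>))"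
    using sum_perms_function_of[OF q, where g = g and f = "\<lambda>x. P x / Q x"]
    unfolding expected_ENT_id_eq[OF p'] by (simp add: sum.distrib sum_subtractf N_def P_def Q_def)
  also have "(\<Sum>x\<in>g ` perms n. Q x * (P x / Q x)) \<le> (\<Sum>x\<in>g ` perms n. P x)"
    by (intro sum_mono) (simp add: P_def Q_def)
  also have "(\<Sum>x\<in>g ` perms n. P x) = (\<Sum>\<sigma>\<in>perms n. pmf p \<sigma>)"
    using sum_perms_function_of[OF p', where g = g and f = "\<lambda>x. 1"] by (simp add: P_def)
  finally show ?thesis unfolding N_def Q_def by (simp only: diff_self add_0_right)
qed

text \<open>
  Write the left-hand side as an average over the components of their expected log-likelihood ratios
  computed from the mixture, and apply Gibbs' inequality to each component.
\<close>

lemma expected_ENT_mixture: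
  assumes fin: "finite (set_pmf Q)" and K: "\<And>i. i \<in> set_pmf Q \<Longrightarrow> set_pmf (K i) \<subseteq> perms n"
  shows "expected_ENT n (bind_pmf Q K) id g \<le> (\<Sum>i\<in>set_pmf Q. pmf Q i * expected_ENT n (K i) id g)"
proof -
  let ?q = "bind_pmf Q K"
  have q: "set_pmf ?q \<subseteq> perms n" using K by auto
  define F where "F \<sigma> = ln (real (card {\<tau> \<in> perms n. g \<tau> = g \<sigma>}) *
    (pmf ?q \<sigma> / pmf (map_pmf g ?q) (g \<sigma>)))" for \<sigma>
  have "pmf ?q \<sigma> = (\<Sum>i\<in>set_pmf Q. pmf Q i * pmf (K i) \<sigma>)" for \<sigma>
    unfolding pmf_bind using fin by (subst integral_measure_pmf_real[of "set_pmf Q"]) (auto simp: mult.commute)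
  then have "expected_ENT n ?q id g = (\<Sum>\<sigma>\<in>perms n. \<Sum>i\<in>set_pmf Q. pmf Q i * (pmf (K i) \<sigma> * F \<sigma>))"
    unfolding expected_ENT_id_eq[OF q] F_def[symmetric] by (simp add: sum_distrib_right mult.assoc)
  also have "\<dots> = (\<Sum>i\<in>set_pmf Q. pmf Q i * (\<Sum>\<sigma>\<in>perms n. pmf (K i) \<sigma> * F \<sigma>))"
    by (subst sum.swap) (simp add: sum_distrib_left)
  also have "\<dots> \<le> (\<Sum>i\<in>set_pmf Q. pmf Q i * expected_ENT n (K i) id g)"
    unfolding F_def
    by (intro sum_mono mult_left_mono gibbs_inequality_conditional q) auto
  finally show ?thesis .
qed

lemma inj_compose_perms: "D \<in> perms n \<Longrightarrow> inj (\<lambda>\<sigma>. D \<circ> \<sigma>)"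
  by (auto simp: perms_iff inj_def fun_eq_iff dest: permutes_inj)

lemma pmf_map_compose_perm:
  assumes "D \<in> perms n"
  shows "pmf (map_pmf (\<lambda>\<sigma>. D \<circ> \<sigma>) p) (D \<circ> \<sigma>) = pmf p \<sigma>"
  by (rule pmf_map_inj'[OF inj_compose_perms[OF assms]])

lemma bij_betw_compose_perms:
  assumes "D \<in> perms n"
  shows "bij_betw (\<lambda>\<sigma>. D \<circ> \<sigma>) (perms n) (perms n)"
proof (rule bij_betwI[where g = "\<lambda>\<sigma>. inv D \<circ> \<sigma>"])
  show "(\<lambda>\<sigma>. D \<circ> \<sigma>) \<in> perms n \<rightarrow> perms n" "(\<lambda>\<sigma>. inv D \<circ> \<sigma>) \<in> perms n \<rightarrow> perms n"
    using assms by (auto intro: compose_perms inv_perms)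
qed (use permutes_inv_o[OF assms[unfolded perms_iff]] in \<open>auto simp: o_assoc\<close>)

lemma permutation_perms: "\<sigma> \<in> perms n \<Longrightarrow> permutation \<sigma>"
  unfolding perms_iff permutation_permutes by blast

lemma sign_compose_perms:
  assumes "D \<in> perms n" "\<sigma> \<in> perms n"
  shows "sign (D \<circ> \<sigma>) = sign D * sign \<sigma>"
  using assms by (intro sign_compose permutation_perms)

text \<open>
  Composition with \<open>D\<close> relabels the permutations and either preserves the two classes of equal sign or
  exchanges them; in the second case it shows that they have the same size.
\<close>

lemma expected_ENT_compose_perm:
  assumes DP: "D \<in> perms n" and p: "set_pmf p \<subseteq> perms n"
  shows "expected_ENT n (map_pmf (\<lambda>\<sigma>. D \<circ> \<sigma>) p) id sign = expected_ENT n p id sign"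
proof -
  let ?q = "map_pmf (\<lambda>\<sigma>. D \<circ> \<sigma>) p"
  have q: "set_pmf ?q \<subseteq> perms n" using p DP by (auto intro: compose_perms)
  have sgn: "sign (D \<circ> \<tau>) = sign (D \<circ> \<sigma>) \<longleftrightarrow> sign \<tau> = sign \<sigma>" if "\<sigma> \<in> perms n" "\<tau> \<in> perms n" for \<sigma> \<tau>
    using that by (simp add: sign_compose_perms[OF DP])
  have card: "card {\<tau> \<in> perms n. sign \<tau> = sign (D \<circ> \<sigma>)} = card {\<tau> \<in> perms n. sign \<tau> = sign \<sigma>}"
    if \<sigma>: "\<sigma> \<in> perms n" for \<sigma>
  proof -
    have "bij_betw (\<lambda>\<sigma>. D \<circ> \<sigma>) {\<tau> \<in> perms n. sign \<tau> = sign \<sigma>} {\<tau> \<in> perms n. sign \<tau> = sign (D \<circ> \<sigma>)}"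
      by (rule bij_betw_subset[OF bij_betw_compose_perms[OF DP]])
        (use bij_betw_imp_surj_on[OF bij_betw_compose_perms[OF DP]] sgn[OF \<sigma>] in \<open>fastforce simp: image_iff\<close>)+
    then show ?thesis by (rule bij_betw_same_card[symmetric])
  qed
  have margin: "pmf (map_pmf sign ?q) (sign (D \<circ> \<sigma>)) = pmf (map_pmf sign p) (sign \<sigma>)"
    if \<sigma>: "\<sigma> \<in> perms n" for \<sigma>
  proof -
    have "map_pmf sign ?q = map_pmf (\<lambda>s. sign D * s) (map_pmf sign p)"
      using p by (auto simp: pmf.map_comp sign_compose_perms[OF DP] intro!: map_pmf_cong)
    moreover have "inj (\<lambda>s. sign D * s)" by (simp add: inj_def)
    ultimately show ?thesis using \<sigma> by (simp add: sign_compose_perms[OF DP] pmf_map_inj')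
  qed
  have "expected_ENT n ?q id sign = (\<Sum>\<sigma>\<in>perms n. pmf ?q (D \<circ> \<sigma>) *
    ln (real (card {\<tau> \<in> perms n. sign \<tau> = sign (D \<circ> \<sigma>)}) *
      (pmf ?q (D \<circ> \<sigma>) / pmf (map_pmf sign ?q) (sign (D \<circ> \<sigma>)))))"
    unfolding expected_ENT_id_eq[OF q]
    by (rule sum.reindex_bij_betw[OF bij_betw_compose_perms[OF DP], symmetric])
  also have "\<dots> = expected_ENT n p id sign"
    unfolding expected_ENT_id_eq[OF p]
    by (intro sum.cong refl) (simp add: pmf_map_compose_perm[OF DP] card margin)
  finally show ?thesis .
qed

section \<open>Products of disjoint 3-collisions\<close>

text \<open>
  The law of a product, in the left-to-right convention, of independent permutations with laws \<open>p\<close>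
  and \<open>q\<close>. Its associativity and the commutation of factors with disjoint support replace the
  manipulation of random variables.
\<close>

definition conv :: "perm pmf \<Rightarrow> perm pmf \<Rightarrow> perm pmf" where
  "conv p q = map_pmf (\<lambda>(\<kappa>, \<rho>). \<rho> \<circ> \<kappa>) (pair_pmf p q)"

lemma conv_eq_bind: "conv p q = bind_pmf p (\<lambda>\<kappa>. map_pmf (\<lambda>\<rho>. \<rho> \<circ> \<kappa>) q)"
  by (simp add: conv_def map_pmf_def pair_pmf_def bind_assoc_pmf bind_return_pmf)

lemma set_conv: "set_pmf (conv p q) = {\<rho> \<circ> \<kappa> | \<kappa> \<rho>. \<kappa> \<in> set_pmf p \<and> \<rho> \<in> set_pmf q}"
  by (auto simp: conv_eq_bind)

lemma conv_assoc: "conv (conv p q) r = conv p (conv q r)"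
  by (simp add: conv_eq_bind map_pmf_def bind_assoc_pmf bind_return_pmf o_assoc)

lemma conv_return_id [simp]: "conv (return_pmf id) p = p" "conv p (return_pmf id) = p"
  by (simp_all add: conv_eq_bind bind_return_pmf map_pmf_def bind_return_pmf')

lemma conv_commute:
  assumes "\<And>\<kappa> \<rho>. \<kappa> \<in> set_pmf p \<Longrightarrow> \<rho> \<in> set_pmf q \<Longrightarrow> \<rho> \<circ> \<kappa> = \<kappa> \<circ> \<rho>"
  shows "conv p q = conv q p"
proof -
  have "conv p q = bind_pmf p (\<lambda>\<kappa>. bind_pmf q (\<lambda>\<rho>. return_pmf (\<kappa> \<circ> \<rho>)))"
    unfolding conv_eq_bind map_pmf_def by (intro bind_pmf_cong refl) (simp add: assms)
  also have "\<dots> = conv q p"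
    unfolding conv_eq_bind map_pmf_def by (rule bind_commute_pmf)
  finally show ?thesis .
qed

lemma collisions_pmf_Cons: "collisions_pmf (t # xs) = conv (collision_pmf t) (collisions_pmf xs)"
  by (simp add: conv_def)

lemma collisions_pmf_single: "collisions_pmf [t] = collision_pmf t"
  by (simp add: collisions_pmf_Cons del: collisions_pmf.simps(2))

lemma collisions_pmf_append: "collisions_pmf (xs @ ys) = conv (collisions_pmf xs) (collisions_pmf ys)"
  by (induction xs) (simp_all add: collisions_pmf_Cons conv_assoc del: collisions_pmf.simps(2))

definition pts :: "triple list \<Rightarrow> nat set" where
  "pts xs = set (concat (map (\<lambda>(x, y, z). [x, y, z]) xs))"

definition disjoint_triples :: "triple list \<Rightarrow> bool" where
  "disjoint_triples xs \<longleftrightarrow> distinct (concat (map (\<lambda>(x, y, z). [x, y, z]) xs))"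

lemma pts_simps [simp]:
  "pts [] = {}" "pts ((a, b, c) # xs) = {a, b, c} \<union> pts xs" "pts (xs @ ys) = pts xs \<union> pts ys"
  by (auto simp: pts_def)

lemma finite_pts [simp]: "finite (pts xs)"
  unfolding pts_def by (rule finite_set)

lemma disjoint_triples_simps [simp]:
  "disjoint_triples []"
  "disjoint_triples ((a, b, c) # xs) \<longleftrightarrow>
    distinct [a, b, c] \<and> {a, b, c} \<inter> pts xs = {} \<and> disjoint_triples xs"
  "disjoint_triples (xs @ ys) \<longleftrightarrow>
    disjoint_triples xs \<and> disjoint_triples ys \<and> pts xs \<inter> pts ys = {}"
  by (auto simp: disjoint_triples_def pts_def)

lemma pts_filter: "pts (filter P xs) \<subseteq> pts xs"
  by (auto simp: pts_def)

lemma disjoint_triples_filter: "disjoint_triples xs \<Longrightarrow> disjoint_triples (filter P xs)"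
  using pts_filter by (induction xs) (fastforce split: prod.splits)+

lemma collision_pmf_cases:
  assumes "\<kappa> \<in> set_pmf (collision_pmf (a, b, c))"
  shows "\<kappa> = id \<or> \<kappa> = cycle_of_list [a, b, c]"
  using assms by (auto split: if_splits)

lemma collisions_permutes: "\<kappa> \<in> set_pmf (collisions_pmf xs) \<Longrightarrow> \<kappa> permutes pts xs"
proof (induction xs arbitrary: \<kappa>)
  case Nil
  then show ?case by (simp add: permutes_id[unfolded id_def] id_def)
next
  case (Cons t xs)
  obtain a b c where t: "t = (a, b, c)" by (cases t)
  obtain \<gamma> \<rho> where *: "\<kappa> = \<rho> \<circ> \<gamma>" "\<gamma> \<in> set_pmf (collision_pmf t)" "\<rho> \<in> set_pmf (collisions_pmf xs)"
    using Cons.prems unfolding collisions_pmf_Cons set_conv by auto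
  have "\<gamma> permutes set [a, b, c]"
    using collision_pmf_cases[of \<gamma> a b c] *(2) permutes_id cycle_permutes unfolding t by metis
  then have "\<gamma> permutes pts (t # xs)" by (rule permutes_subset) (auto simp: t)
  moreover have "\<rho> permutes pts (t # xs)"
    using Cons.IH[OF *(3)] by (rule permutes_subset) (auto simp: t)
  ultimately show ?case unfolding *(1) by (rule permutes_compose)
qed

lemma permutes_disjoint_commute:
  assumes \<kappa>: "\<kappa> permutes A" and \<rho>: "\<rho> permutes B" and "A \<inter> B = {}"
  shows "\<rho> \<circ> \<kappa> = \<kappa> \<circ> \<rho>"
proof
  fix x
  consider "x \<in> A" | "x \<in> B" | "x \<notin> A" "x \<notin> B" by blast
  then show "(\<rho> \<circ> \<kappa>) x = (\<kappa> \<circ> \<rho>) x"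
  proof cases
    case 1
    then have "\<kappa> x \<notin> B" "x \<notin> B" using permutes_in_image[OF \<kappa>, of x] assms(3) by auto
    then show ?thesis using permutes_not_in[OF \<rho>] by simp
  next
    case 2
    then have "\<rho> x \<notin> A" "x \<notin> A" using permutes_in_image[OF \<rho>, of x] assms(3) by auto
    then show ?thesis using permutes_not_in[OF \<kappa>] by simp
  next
    case 3
    then show ?thesis using permutes_not_in[OF \<kappa>] permutes_not_in[OF \<rho>] by simp
  qed
qed

lemma conv_collisions_commute:
  assumes "pts xs \<inter> pts ys = {}"
  shows "conv (collisions_pmf xs) (collisions_pmf ys) = conv (collisions_pmf ys) (collisions_pmf xs)"
  by (intro conv_commute permutes_disjoint_commute[OF collisions_permutes collisions_permutes assms])

text \<open>
  Disjoint collisions commute, so any subfamily can be performed first.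
\<close>

lemma collisions_pmf_partition:
  assumes "disjoint_triples xs"
  shows "collisions_pmf xs =
    conv (collisions_pmf (filter P xs)) (collisions_pmf (filter (\<lambda>t. \<not> P t) xs))"
  using assms
proof (induction xs)
  case Nil
  then show ?case by simp
next
  case (Cons t xs)
  obtain a b c where t: "t = (a, b, c)" by (cases t)
  let ?F = "collisions_pmf (filter P xs)" and ?G = "collisions_pmf (filter (\<lambda>t. \<not> P t) xs)"
  have xs: "disjoint_triples xs" "{a, b, c} \<inter> pts xs = {}" using Cons.prems by (auto simp: t)
  have "conv (collision_pmf t) ?F = conv ?F (collision_pmf t)"
    using conv_collisions_commute[of "[t]" "filter P xs"] xs pts_filter[of P xs]
    unfolding collisions_pmf_single by (fastforce simp: t)
  then show ?case
    unfolding collisions_pmf_Cons Cons.IH[OF xs(1)]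
    by (cases "P t") (simp_all only: filter.simps if_True if_False not_False_eq_True not_True_eq_False
        collisions_pmf_Cons conv_assoc conv_assoc[symmetric, of "collision_pmf t"])
qed

definition map_triple :: "(nat \<Rightarrow> nat) \<Rightarrow> triple \<Rightarrow> triple" where
  "map_triple f = (\<lambda>(a, b, c). (f a, f b, f c))"

lemma map_triple_simp [simp]: "map_triple f (a, b, c) = (f a, f b, f c)"
  by (simp add: map_triple_def)

lemma pts_map [simp]: "pts (map (map_triple f) xs) = f ` pts xs"
  by (induction xs) (auto split: prod.splits)

lemma disjoint_triples_map:
  "disjoint_triples xs \<Longrightarrow> inj f \<Longrightarrow> disjoint_triples (map (map_triple f) xs)"
  by (induction xs) (auto simp: inj_eq split: prod.splits)

text \<open>
  Translates between positions and cards: for the deck \<open>g\<close>, collisions of positions performed after \<open>g\<close>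
  are collisions, performed before \<open>g\<close>, of the cards in these positions. The 3-cycles are conjugate.
\<close>

lemma collisions_pmf_conjugate:
  assumes "disjoint_triples xs" and g: "bij g"
  shows "collisions_pmf (map (map_triple g) xs) = map_pmf (\<lambda>\<kappa>. g \<circ> \<kappa> \<circ> inv g) (collisions_pmf xs)"
  using assms(1)
proof (induction xs)
  case Nil
  have "g \<circ> inv g = id" using g by (simp add: bij_is_surj flip: surj_iff)
  then show ?case by (simp add: id_def comp_def)
next
  case (Cons t xs)
  obtain a b c where t: "t = (a, b, c)" by (cases t)
  have inv: "inv g \<circ> g = id" "g \<circ> inv g = id"
    using g by (simp_all add: bij_is_inj bij_is_surj flip: surj_iff)
  have hom: "map_pmf (\<lambda>\<kappa>. g \<circ> \<kappa> \<circ> inv g) (conv p q) =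
      conv (map_pmf (\<lambda>\<kappa>. g \<circ> \<kappa> \<circ> inv g) p) (map_pmf (\<lambda>\<kappa>. g \<circ> \<kappa> \<circ> inv g) q)" for p q
  proof -
    have "g \<circ> (\<rho> \<circ> \<kappa>) \<circ> inv g = (g \<circ> \<rho> \<circ> inv g) \<circ> (g \<circ> \<kappa> \<circ> inv g)" for \<rho> \<kappa> :: perm
      using inv(1) by (metis comp_assoc comp_id)
    then show ?thesis
      by (simp add: conv_eq_bind map_pmf_def bind_assoc_pmf bind_return_pmf)
  qed
  have "g \<circ> cycle_of_list [a, b, c] \<circ> inv g = cycle_of_list [g a, g b, g c]"
    using conjugation_of_cycle[of "[a, b, c]" g] Cons.prems g by (simp add: t)
  then have "collision_pmf (map_triple g t) = map_pmf (\<lambda>\<kappa>. g \<circ> \<kappa> \<circ> inv g) (collision_pmf t)"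
    using inv(2) unfolding t map_triple_simp collision_pmf.simps pmf.map_comp
    by (intro map_pmf_cong refl) auto
  moreover have "disjoint_triples xs" using Cons.prems by (simp add: t)
  ultimately show ?case
    using Cons.IH by (simp only: list.map collisions_pmf_Cons hom)
qed

lemma has_collision_Nil [simp]: "\<not> has_collision [] i j k"
  by (simp add: has_collision_def)

lemma has_collision_Cons:
  "has_collision (t # xs) i j k \<longleftrightarrow> t \<in> {(i, j, k), (j, k, i), (k, i, j)} \<or> has_collision xs i j k"
  by (auto simp: has_collision_def)

lemma has_collision_append:
  "has_collision (xs @ ys) i j k \<longleftrightarrow> has_collision xs i j k \<or> has_collision ys i j k"
  by (auto simp: has_collision_def)

lemma has_collision_rotate: "has_collision xs i j k \<longleftrightarrow> has_collision xs j k i"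
  by (auto simp: has_collision_def)

lemma has_collision_pts: "has_collision xs i j k \<Longrightarrow> {i, j, k} \<subseteq> pts xs"
  by (auto simp: has_collision_def pts_def)

lemma pts_has_collision: "w \<in> pts xs \<Longrightarrow> \<exists>j k. has_collision xs w j k"
  by (fastforce simp: has_collision_def pts_def)

lemma has_collision_distinct:
  "disjoint_triples xs \<Longrightarrow> has_collision xs i j k \<Longrightarrow> distinct [i, j, k]"
  by (induction xs) (auto simp: has_collision_Cons)

lemma has_collision_unique:
  "disjoint_triples xs \<Longrightarrow> has_collision xs i j k \<Longrightarrow> has_collision xs i j' k' \<Longrightarrow> j = j' \<and> k = k'"
  by (induction xs) (auto simp: has_collision_Cons dest: has_collision_pts)

lemma has_collision_map:
  assumes "bij g"
  shows "has_collision (map (map_triple (inv g)) xs) x y z \<longleftrightarrow> has_collision xs (g x) (g y) (g z)"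
proof -
  have *: "inv g a = u \<longleftrightarrow> a = g u" for u a using assms by (metis bij_inv_eq_iff)
  show ?thesis
  proof (induction xs)
    case (Cons t xs)
    then show ?case by (cases t) (simp add: has_collision_Cons *)
  qed simp
qed

lemma has_collision_filter:
  "has_collision (filter (\<lambda>(a, b, c). Q a \<and> Q b \<and> Q c) xs) i j k \<longleftrightarrow>
    has_collision xs i j k \<and> Q i \<and> Q j \<and> Q k"
  by (auto simp: has_collision_def)

text \<open>
  A coin that shows heads rotates its triple, and \<open>has_collision\<close> does not see rotations. This gives one
  direction; the other one follows since \<open>\<kappa>\<close> acts injectively on the finite set of collision triples.
\<close>

lemma has_collision_collisions:
  assumes "disjoint_triples xs" "\<kappa> \<in> set_pmf (collisions_pmf xs)"
  shows "has_collision xs (\<kappa> i) (\<kappa> j) (\<kappa> k) \<longleftrightarrow> has_collision xs i j k"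
proof -
  have imp: "has_collision xs i j k \<Longrightarrow> has_collision xs (\<kappa> i) (\<kappa> j) (\<kappa> k)" for i j k
    using assms
  proof (induction xs arbitrary: \<kappa> i j k)
    case (Cons t xs)
    obtain a b c where t: "t = (a, b, c)" by (cases t)
    have abc: "distinct [a, b, c]" "{a, b, c} \<inter> pts xs = {}" "disjoint_triples xs"
      using Cons.prems by (auto simp: t)
    obtain \<gamma> \<rho> where *: "\<kappa> = \<rho> \<circ> \<gamma>" "\<gamma> \<in> set_pmf (collision_pmf t)"
        "\<rho> \<in> set_pmf (collisions_pmf xs)"
      using Cons.prems unfolding collisions_pmf_Cons set_conv by auto
    have \<gamma>: "\<gamma> = id \<or> \<gamma> = cycle_of_list [a, b, c]" using collision_pmf_cases *(2) by (simp add: t)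
    have \<gamma>p: "\<gamma> u = u" if "u \<notin> {a, b, c}" for u
      using \<gamma> that by (auto simp: transpose_def)
    have \<gamma>t: "(\<gamma> a, \<gamma> b, \<gamma> c) \<in> {(a, b, c), (b, c, a)}"
      using \<gamma> abc(1) by (auto simp: transpose_def)
    have \<rho>: "\<rho> u = u" if "u \<in> {a, b, c}" for u
      using collisions_permutes[OF *(3)] abc(2) that by (auto dest: permutes_not_in)
    show ?case
    proof (cases "has_collision xs i j k")
      case True
      then have "\<gamma> i = i" "\<gamma> j = j" "\<gamma> k = k"
        using has_collision_pts[OF True] abc(2) by (auto intro!: \<gamma>p)
      then show ?thesis using Cons.IH[OF True abc(3) *(3)] by (simp add: *(1) has_collision_Cons)
    next
      case False
      then have "(a, b, c) \<in> {(i, j, k), (j, k, i), (k, i, j)}"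
        using Cons.prems(1) by (simp add: t has_collision_Cons)
      then consider "i = a" "j = b" "k = c" | "j = a" "k = b" "i = c" | "k = a" "i = b" "j = c"
        by blast
      moreover have "(\<kappa> a, \<kappa> b, \<kappa> c) = (a, b, c) \<or> (\<kappa> a, \<kappa> b, \<kappa> c) = (b, c, a)"
        using \<gamma>t \<rho> unfolding *(1) comp_apply by force
      then have "has_collision (t # xs) (\<kappa> a) (\<kappa> b) (\<kappa> c)"
        unfolding t has_collision_Cons by (elim disjE) simp_all
      ultimately show ?thesis
        using has_collision_rotate by cases (blast, metis, metis)
    qed
  qed simp
  have \<kappa>: "inj \<kappa>" using collisions_permutes[OF assms(2)] by (rule permutes_inj)
  let ?C = "{(i, j, k). has_collision xs i j k}"
  have "(i, j, k) \<in> pts xs \<times> pts xs \<times> pts xs" if "has_collision xs i j k" for i j k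
    using has_collision_pts[OF that] by simp
  then have "?C \<subseteq> pts xs \<times> pts xs \<times> pts xs" by blast
  then have "finite ?C" by (rule finite_subset) simp
  moreover have "map_triple \<kappa> ` ?C \<subseteq> ?C" using imp by auto
  moreover have injt: "inj (map_triple \<kappa>)" using \<kappa> by (auto simp: inj_def)
  ultimately have "map_triple \<kappa> ` ?C = ?C"
    by (intro endo_inj_surj inj_on_subset[OF injt]) auto
  then have "map_triple \<kappa> (i, j, k) \<in> map_triple \<kappa> ` ?C \<longleftrightarrow> map_triple \<kappa> (i, j, k) \<in> ?C"
    by (simp only:)
  then show ?thesis unfolding inj_image_mem_iff[OF injt] by simp
qed

section \<open>The loss of entropy in a 3-collision\<close>

text \<open>
  Instance of subadditivity: the probability of an observation \<open>f \<sigma> = v\<close> is the sum over the permutations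
  that produce it.
\<close>

lemma js_data_processing:
  assumes p: "set_pmf p \<subseteq> perms n" and p': "set_pmf p' \<subseteq> perms n"
    and W: "finite W" "f ` perms n \<subseteq> W"
  shows "(\<Sum>v\<in>W. js (pmf (map_pmf f p) v) (pmf (map_pmf f p') v)) \<le> (\<Sum>\<sigma>\<in>perms n. js (pmf p \<sigma>) (pmf p' \<sigma>))"
proof -
  have m: "pmf (map_pmf f q) v = (\<Sum>\<sigma> | \<sigma> \<in> perms n \<and> f \<sigma> = v. pmf q \<sigma>)"
    if "set_pmf q \<subseteq> perms n" for q v
    by (simp add: sum_pmf_perms_eq_prob[OF that] pmf_map vimage_def)
  have "(\<Sum>v\<in>W. js (pmf (map_pmf f p) v) (pmf (map_pmf f p') v)) \<le>
      (\<Sum>v\<in>W. \<Sum>\<sigma> | \<sigma> \<in> perms n \<and> f \<sigma> = v. js (pmf p \<sigma>) (pmf p' \<sigma>))"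
    unfolding m[OF p] m[OF p'] by (intro sum_mono js_sum_le) auto
  also have "\<dots> = (\<Sum>\<sigma>\<in>perms n. js (pmf p \<sigma>) (pmf p' \<sigma>))"
    by (rule sum.group) (use W in auto)
  finally show ?thesis .
qed

lemma expected_ENT_id_split:
  assumes p: "set_pmf p \<subseteq> perms n"
  shows "expected_ENT n p id g = (\<Sum>\<sigma>\<in>perms n. pmf p \<sigma> * ln (pmf p \<sigma>)) +
    (\<Sum>x\<in>g ` perms n. pmf (map_pmf g p) x *
      ln (real (card {\<tau> \<in> perms n. g \<tau> = x}) / pmf (map_pmf g p) x))"
proof -
  define L where "L x = ln (real (card {\<tau> \<in> perms n. g \<tau> = x}) / pmf (map_pmf g p) x)" for x
  have "pmf p \<sigma> * ln (real (card {\<tau> \<in> perms n. g \<tau> = g \<sigma>}) * (pmf p \<sigma> / pmf (map_pmf g p) (g \<sigma>)))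
      = pmf p \<sigma> * ln (pmf p \<sigma>) + pmf p \<sigma> * L (g \<sigma>)" if \<sigma>: "\<sigma> \<in> perms n" for \<sigma>
  proof (cases "pmf p \<sigma> = 0")
    case False
    then have "pmf p \<sigma> > 0" by (simp add: less_le)
    moreover have "pmf (map_pmf g p) (g \<sigma>) > 0" using calculation pmf_le_pmf_map[of p \<sigma> g] by simp
    moreover have "card {\<tau> \<in> perms n. g \<tau> = g \<sigma>} > 0"
      using \<sigma> by (intro card_gt_0_iff[THEN iffD2]) auto
    ultimately have "ln (pmf p \<sigma> * (real (card {\<tau> \<in> perms n. g \<tau> = g \<sigma>}) / pmf (map_pmf g p) (g \<sigma>)))
       = ln (pmf p \<sigma>) + L (g \<sigma>)"
      unfolding L_def by (intro ln_mult_pos) auto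
    then show ?thesis by (simp add: mult.commute distrib_left)
  qed simp
  then show ?thesis
    unfolding expected_ENT_id_eq[OF p] using sum_perms_function_of[OF p, where g = g and f = L]
    by (simp add: sum.distrib L_def)
qed

lemma map_conv_invariant:
  assumes "\<And>\<kappa> \<rho>. \<kappa> \<in> set_pmf p \<Longrightarrow> \<rho> \<in> set_pmf q \<Longrightarrow> H (\<rho> \<circ> \<kappa>) = H \<kappa>"
  shows "map_pmf H (conv p q) = map_pmf H p"
proof -
  have "map_pmf H (conv p q) = bind_pmf p (\<lambda>\<kappa>. bind_pmf q (\<lambda>\<rho>. return_pmf (H (\<rho> \<circ> \<kappa>))))"
    by (simp add: conv_eq_bind map_pmf_def bind_assoc_pmf bind_return_pmf)
  also have "\<dots> = bind_pmf p (\<lambda>\<kappa>. bind_pmf q (\<lambda>\<rho>. return_pmf (H \<kappa>)))"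
    by (intro bind_pmf_cong refl) (simp add: assms)
  finally show ?thesis by (simp add: map_pmf_def)
qed

lemma conv_perms: "set_pmf p \<subseteq> perms n \<Longrightarrow> set_pmf q \<subseteq> perms n \<Longrightarrow> set_pmf (conv p q) \<subseteq> perms n"
  unfolding set_conv by (auto intro: compose_perms)

text \<open>
  The coin does not change the law of the sign, so in the decomposition of the conditional entropy
  (\<open>expected_ENT_id_split\<close>) only the sum of the terms \<open>p ln p\<close> changes. The laws of \<open>\<sigma>\<close> and of \<open>c \<circ> \<sigma>\<close> have the
  same value of this sum.
\<close>

lemma expected_ENT_coin:
  assumes p: "set_pmf p \<subseteq> perms n" and c: "c \<in> perms n" "sign c = 1"
  shows "expected_ENT n (conv p (map_pmf (\<lambda>h. if h then c else id) (bernoulli_pmf (1/2)))) id sign =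
    expected_ENT n p id sign - (\<Sum>\<sigma>\<in>perms n. js (pmf p \<sigma>) (pmf (map_pmf (\<lambda>\<sigma>. c \<circ> \<sigma>) p) \<sigma>))"
proof -
  let ?r = "map_pmf (\<lambda>h. if h then c else id) (bernoulli_pmf (1/2))"
  let ?q = "conv p ?r" and ?p' = "map_pmf (\<lambda>\<sigma>. c \<circ> \<sigma>) p"
  have r: "set_pmf ?r \<subseteq> perms n" using c id_perms by auto
  have q: "set_pmf ?q \<subseteq> perms n" by (rule conv_perms[OF p r])
  have "?q = bind_pmf (bernoulli_pmf (1/2)) (\<lambda>h. map_pmf (\<lambda>\<sigma>. (if h then c else id) \<circ> \<sigma>) p)"
    unfolding conv_eq_bind map_pmf_def by (subst bind_commute_pmf) (simp add: bind_assoc_pmf bind_return_pmf)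
  moreover have "map_pmf ((\<circ>) id) p = p"
    using map_pmf_cong[OF refl, of p "(\<circ>) id" "\<lambda>\<sigma>. \<sigma>"] by simp
  ultimately have pq: "pmf ?q \<sigma> = (pmf p \<sigma> + pmf ?p' \<sigma>) / 2" for \<sigma>
    by (simp add: pmf_bind)
  have "map_pmf sign ?q = map_pmf sign p"
  proof (rule map_conv_invariant)
    fix \<kappa> \<rho> assume "\<kappa> \<in> set_pmf p" "\<rho> \<in> set_pmf ?r"
    then have "\<kappa> \<in> perms n" "\<rho> \<in> perms n" "sign \<rho> = 1" using p r c by (auto split: if_splits)
    then show "sign (\<rho> \<circ> \<kappa>) = sign \<kappa>" by (simp add: sign_compose_perms)
  qed
  moreover have "(\<Sum>\<sigma>\<in>perms n. pmf ?p' \<sigma> * ln (pmf ?p' \<sigma>)) = (\<Sum>\<sigma>\<in>perms n. pmf p \<sigma> * ln (pmf p \<sigma>))"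
    using sum.reindex_bij_betw[OF bij_betw_compose_perms[OF c(1)], of "\<lambda>\<sigma>. pmf ?p' \<sigma> * ln (pmf ?p' \<sigma>)"]
    by (simp add: pmf_map_compose_perm[OF c(1)])
  ultimately show ?thesis
    unfolding expected_ENT_id_split[OF q] expected_ENT_id_split[OF p] js_def pq
    by (simp add: sum.distrib sum_subtractf flip: sum_divide_distrib)
qed

lemma sign_three_cycle:
  assumes "distinct [a, b, c]"
  shows "sign (cycle_of_list [a, b, c]) = 1"
  using assms by (simp add: sign_compose sign_swap_id permutation_swap_id permutation_compose)

lemma collisions_perms: "pts xs \<subseteq> {1..n} \<Longrightarrow> set_pmf (collisions_pmf xs) \<subseteq> perms n"
  unfolding perms_def using permutes_subset[OF collisions_permutes] by blast

lemma sign_collisions: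
  assumes "disjoint_triples xs" "\<kappa> \<in> set_pmf (collisions_pmf xs)"
  shows "sign \<kappa> = 1"
  using assms
proof (induction xs arbitrary: \<kappa>)
  case Nil
  then show ?case by (simp add: sign_id[unfolded id_def] id_def)
next
  case (Cons t xs)
  obtain a b c where t: "t = (a, b, c)" by (cases t)
  obtain \<gamma> \<rho> where *: "\<kappa> = \<rho> \<circ> \<gamma>" "\<gamma> \<in> set_pmf (collision_pmf t)" "\<rho> \<in> set_pmf (collisions_pmf xs)"
    using Cons.prems unfolding collisions_pmf_Cons set_conv by auto
  have "sign \<gamma> = 1"
    using collision_pmf_cases[of \<gamma> a b c] *(2) sign_three_cycle[of a b c] Cons.prems(1)
    unfolding t by (metis disjoint_triples_simps(2) sign_id)
  moreover have "sign \<rho> = 1" using Cons.IH *(3) Cons.prems(1) by (simp add: t)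
  moreover have "permutation \<gamma>" "permutation \<rho>"
    using collisions_permutes[of \<gamma> "[t]"] collisions_permutes[OF *(3)] *(2)
    unfolding collisions_pmf_single permutation_permutes by (meson finite_pts)+
  ultimately show ?case unfolding *(1) by (simp only: sign_compose mult_1)
qed

definition card_and_tail :: "nat \<Rightarrow> nat \<Rightarrow> nat \<Rightarrow> perm \<Rightarrow> nat \<times> nat list \<times> int" where
  "card_and_tail n k j \<sigma> = (inv \<sigma> j, signed_tail n (k + 1) \<sigma>)"

definition cards_and_tails :: "nat \<Rightarrow> nat \<Rightarrow> (nat \<times> nat list \<times> int) set" where
  "cards_and_tails n k = {1..n} \<times> signed_tail n (k + 1) ` perms n"

text \<open>
  The divergence between the laws of the cards in positions \<open>k\<close> and \<open>j\<close> given the signed tail above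
  \<open>k\<close>, averaged over that tail. The joint laws with the tail are compared, which amounts to the same because
  \<open>js\<close> is homogeneous.
\<close>

definition exchange_gain :: "nat \<Rightarrow> perm pmf \<Rightarrow> nat \<Rightarrow> nat \<Rightarrow> real" where
  "exchange_gain n p k j = (\<Sum>v\<in>cards_and_tails n k.
     js (pmf (map_pmf (card_and_tail n k k) p) v) (pmf (map_pmf (card_and_tail n k j) p) v))"

lemma finite_cards_and_tails [simp]: "finite (cards_and_tails n k)"
  by (simp add: cards_and_tails_def)

lemma card_and_tail_in:
  assumes "j \<in> {1..n}" "\<sigma> \<in> perms n"
  shows "card_and_tail n k j \<sigma> \<in> cards_and_tails n k"
proof -
  have "inv \<sigma> permutes {1..n}" using inv_perms[OF assms(2)] unfolding perms_iff .
  then have "inv \<sigma> j \<in> {1..n}" using assms(1) by (simp only: permutes_in_image)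
  then show ?thesis using assms(2) by (simp add: card_and_tail_def cards_and_tails_def)
qed

lemma exchange_gain_nonneg: "0 \<le> exchange_gain n p k j"
  unfolding exchange_gain_def by (intro sum_nonneg js_nonneg) auto

lemma exchange_gain_same [simp]: "exchange_gain n p k k = 0"
  by (simp add: exchange_gain_def)

lemma inv_compose_perms:
  assumes "c \<in> perms n" "\<sigma> \<in> perms n"
  shows "inv (c \<circ> \<sigma>) i = inv \<sigma> (inv c i)"
  using assms by (simp add: perms_iff permutes_bij o_inv_distrib)

text \<open>
  If \<open>c\<close> moves the contents of position \<open>i\<close> to position \<open>j\<close> and leaves the tail and the sign alone, then
  looking at position \<open>j\<close> afterwards is the same as looking at position \<open>i\<close> before.
\<close>

lemma card_and_tail_compose:
  assumes "c \<in> perms n" "\<sigma> \<in> perms n" "sign c = 1" "c i = j" "\<And>m. m > k \<Longrightarrow> c m = m"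
  shows "card_and_tail n k j (c \<circ> \<sigma>) = card_and_tail n k i \<sigma>"
proof -
  have c: "inj c" using assms(1) unfolding perms_iff by (rule permutes_inj)
  have "inv c j = i" using inv_f_f[OF c, of i] assms(4) by simp
  moreover have "inv c m = m" if "Suc k \<le> m" for m using inv_f_f[OF c, of m] assms(5)[of m] that by simp
  ultimately show ?thesis
    using assms by (simp add: card_and_tail_def signed_tail_def tail_def inv_compose_perms sign_compose_perms del: upt_Suc)
qed

text \<open>
  Heads brings the card from position \<open>j\<close> to position \<open>k\<close>. The inequality \<open>y < k\<close> makes sure that
  the tail above \<open>k\<close> stays in place.
\<close>

lemma expected_ENT_collision:
  assumes p: "set_pmf p \<subseteq> perms n" and k: "k \<in> {1..n}" "j \<in> {1..n}" "y \<in> {1..n}"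
    and d: "distinct [k, y, j]" "y < k" "j < k"
  shows "expected_ENT n (conv p (collision_pmf (k, y, j))) id sign \<le>
    expected_ENT n p id sign - exchange_gain n p k j"
proof -
  let ?c = "cycle_of_list [k, y, j]"
  have c: "?c \<in> perms n" unfolding perms_iff
    by (rule permutes_subset[OF cycle_permutes]) (use k in auto)
  have sc: "sign ?c = 1" by (rule sign_three_cycle[OF d(1)])
  let ?p' = "map_pmf (\<lambda>\<sigma>. ?c \<circ> \<sigma>) p"
  have p': "set_pmf ?p' \<subseteq> perms n" using p compose_perms[OF c] by auto
  have "?c j = k" "\<And>m. m > k \<Longrightarrow> ?c m = m" using d by (auto simp: transpose_def)
  then have "map_pmf (card_and_tail n k k) ?p' = map_pmf (card_and_tail n k j) p"
    unfolding pmf.map_comp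
    using p by (intro map_pmf_cong refl) (auto simp del: cycle_of_list.simps intro!: card_and_tail_compose[OF c _ sc])
  then have "exchange_gain n p k j = (\<Sum>v\<in>cards_and_tails n k.
     js (pmf (map_pmf (card_and_tail n k k) p) v) (pmf (map_pmf (card_and_tail n k k) ?p') v))"
    by (simp add: exchange_gain_def)
  also have "\<dots> \<le> (\<Sum>\<sigma>\<in>perms n. js (pmf p \<sigma>) (pmf ?p' \<sigma>))"
    by (rule js_data_processing[OF p p']) (use k card_and_tail_in in auto)
  finally show ?thesis
    using expected_ENT_coin[OF p c sc] by (simp del: cycle_of_list.simps)
qed

text \<open>
  Collisions below \<open>k\<close> that avoid position \<open>j\<close> do not touch any of the data that the gain depends on.
\<close>

lemma exchange_gain_collisions:
  assumes p: "set_pmf p \<subseteq> perms n" and xs: "disjoint_triples xs" "pts xs \<subseteq> {1..<k}" "j \<notin> pts xs"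
    and k: "k \<le> n"
  shows "exchange_gain n (conv p (collisions_pmf xs)) k j = exchange_gain n p k j"
proof -
  have "map_pmf (card_and_tail n k i) (conv p (collisions_pmf xs)) = map_pmf (card_and_tail n k i) p"
    if i: "i \<notin> pts xs" for i
  proof (rule map_conv_invariant)
    fix \<sigma> \<kappa> assume \<sigma>: "\<sigma> \<in> set_pmf p" and \<kappa>: "\<kappa> \<in> set_pmf (collisions_pmf xs)"
    have "pts xs \<subseteq> {1..n}" using xs(2) k by auto
    then have \<kappa>n: "\<kappa> \<in> perms n" using collisions_perms \<kappa> by blast
    have fixed: "\<kappa> m = m" if "m \<notin> pts xs" for m
      using collisions_permutes[OF \<kappa>] that by (rule permutes_not_in)
    show "card_and_tail n k i (\<kappa> \<circ> \<sigma>) = card_and_tail n k i \<sigma>"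
    proof (rule card_and_tail_compose[OF \<kappa>n _ sign_collisions[OF xs(1) \<kappa>] fixed[OF i]])
      show "\<sigma> \<in> perms n" using \<sigma> p by blast
      fix m assume "k < m"
      then have "m \<notin> pts xs" using xs(2) by auto
      then show "\<kappa> m = m" by (rule fixed)
    qed
  qed
  moreover have "k \<notin> pts xs" using xs(2) by auto
  ultimately show ?thesis unfolding exchange_gain_def using xs(3) by simp
qed

text \<open>
  For triples that are the matched collisions, these are the pairs of a card \<open>k\<close> and its back match \<open>j\<close>,
  restricted to those \<open>k\<close> that are larger than both partners.
\<close>

definition back_pairs :: "triple list \<Rightarrow> (nat \<times> nat) set" where
  "back_pairs xs = {(k, j). \<exists>y<k. j < k \<and> has_collision xs k y j}"

lemma finite_back_pairs [simp]: "finite (back_pairs xs)"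
proof (rule finite_subset)
  show "back_pairs xs \<subseteq> pts xs \<times> pts xs"
  proof (clarify, unfold back_pairs_def, clarify)
    fix k j y assume "has_collision xs k y j"
    from has_collision_pts[OF this] show "k \<in> pts xs \<and> j \<in> pts xs" by simp
  qed
qed simp

lemma collision_pmf_rotate:
  assumes "distinct [a, b, c]"
  shows "collision_pmf (b, c, a) = collision_pmf (a, b, c)"
proof -
  have "cycle_of_list [b, c, a] x = cycle_of_list [a, b, c] x" for x
  proof -
    consider "x = a" | "x = b" | "x = c" | "x \<notin> {a, b, c}" by blast
    then show ?thesis using assms by cases (simp_all add: transpose_def)
  qed
  then have "cycle_of_list [b, c, a] = cycle_of_list [a, b, c]" by blast
  then show ?thesis by (simp only: collision_pmf.simps)
qed

text \<open>
  The order of the collisions matters for the proof: the triple with the largest entry is performed last.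
  The other triples then lie below its largest entry and avoid its other entries, so
  that \<open>exchange_gain_collisions\<close> reduces its gain to that of \<open>p\<close>.
\<close>

lemma expected_ENT_collisions:
  assumes p: "set_pmf p \<subseteq> perms n" and "disjoint_triples xs" "pts xs \<subseteq> {1..n}"
  shows "expected_ENT n (conv p (collisions_pmf xs)) id sign \<le>
    expected_ENT n p id sign - (\<Sum>(k, j)\<in>back_pairs xs. exchange_gain n p k j)"
  using assms(2,3)
proof (induction "length xs" arbitrary: xs)
  case 0
  then show ?case by (simp add: back_pairs_def)
next
  case (Suc m)
  define k where "k = Max (pts xs)"
  have "pts xs \<noteq> {}" using Suc.hyps(2) by (cases xs) auto
  then have k: "k \<in> pts xs" "\<And>w. w \<in> pts xs \<Longrightarrow> w \<le> k" by (auto simp: k_def)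
  obtain y j where kyj: "has_collision xs k y j" using pts_has_collision[OF k(1)] by auto
  note dist = has_collision_distinct[OF Suc.prems(1) kyj]
  have yj: "y \<in> pts xs" "j \<in> pts xs" using has_collision_pts[OF kyj] by auto
  then have less: "y < k" "j < k" using k(2)[of y] k(2)[of j] dist by auto
  obtain t where t: "t \<in> set xs" "t \<in> {(k, y, j), (y, j, k), (j, k, y)}"
    using kyj by (auto simp: has_collision_def)
  have ct: "collision_pmf t = collision_pmf (k, y, j)"
    using t(2) dist collision_pmf_rotate[of k y j] collision_pmf_rotate[of y j k] by auto
  have pt: "pts [t] = {k, y, j}" using t(2) by auto
  obtain as bs where xs: "xs = as @ t # bs" using split_list[OF t(1)] by auto
  let ?ys = "as @ bs"
  have pxs: "pts xs = {k, y, j} \<union> pts ?ys" using t(2) by (auto simp: xs)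
  have ys: "disjoint_triples ?ys" "{k, y, j} \<inter> pts ?ys = {}" "pts bs \<inter> {k, y, j} = {}"
    using Suc.prems(1) t(2) by (auto simp: xs)
  have ysn: "pts ?ys \<subseteq> {1..n}" using Suc.prems(2) pxs by auto
  have "collisions_pmf xs = conv (collisions_pmf ?ys) (collision_pmf t)"
    unfolding xs collisions_pmf_append collisions_pmf_Cons
    using conv_collisions_commute[of "[t]" bs] ys(3) unfolding collisions_pmf_single pt
    by (simp add: conv_assoc Int_commute)
  then have split: "conv p (collisions_pmf xs) = conv (conv p (collisions_pmf ?ys)) (collision_pmf (k, y, j))"
    by (simp add: conv_assoc ct)
  have p': "set_pmf (conv p (collisions_pmf ?ys)) \<subseteq> perms n"
    by (rule conv_perms[OF p collisions_perms[OF ysn]])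
  have "expected_ENT n (conv p (collisions_pmf xs)) id sign \<le>
      expected_ENT n (conv p (collisions_pmf ?ys)) id sign - exchange_gain n (conv p (collisions_pmf ?ys)) k j"
    unfolding split using Suc.prems(2) k(1) yj dist less by (intro expected_ENT_collision[OF p']) auto
  moreover have "exchange_gain n (conv p (collisions_pmf ?ys)) k j = exchange_gain n p k j"
  proof (rule exchange_gain_collisions[OF p ys(1)])
    show "pts ?ys \<subseteq> {1..<k}"
    proof
      fix w assume w: "w \<in> pts ?ys"
      then have "w \<noteq> k" "w \<le> k" "w \<in> {1..n}" using ys(2) ysn k(2)[of w] pxs by blast+
      then show "w \<in> {1..<k}" by simp
    qed
    show "j \<notin> pts ?ys" using ys(2) by blast
    show "k \<le> n" using k(1) Suc.prems(2) by auto
  qed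

  moreover have "expected_ENT n (conv p (collisions_pmf ?ys)) id sign \<le>
      expected_ENT n p id sign - (\<Sum>(k, j)\<in>back_pairs ?ys. exchange_gain n p k j)"
    using Suc.hyps(1)[of ?ys] Suc.hyps(2) ys(1) ysn by (simp add: xs)
  moreover have "(\<Sum>(k, j)\<in>back_pairs xs. exchange_gain n p k j) \<le>
      exchange_gain n p k j + (\<Sum>(k, j)\<in>back_pairs ?ys. exchange_gain n p k j)"
  proof -
    let ?g = "\<lambda>(k, j). exchange_gain n p k j"
    have "back_pairs xs \<subseteq> insert (k, j) (back_pairs ?ys)"
    proof
      fix v assume v: "v \<in> back_pairs xs"
      obtain k' j' where v': "v = (k', j')" by (cases v)
      obtain y' where y': "y' < k'" "j' < k'" "has_collision xs k' y' j'"
        using v unfolding v' back_pairs_def by blast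
      show "v \<in> insert (k, j) (back_pairs ?ys)"
      proof (cases "has_collision ?ys k' y' j'")
        case True
        then show ?thesis using y' unfolding v' back_pairs_def by blast
      next
        case False
        then have "t \<in> {(k', y', j'), (y', j', k'), (j', k', y')}"
          using y'(3) unfolding xs has_collision_append has_collision_Cons by blast
        then have "k' = k \<and> j' = j" using t(2) y'(1,2) less by force
        then show ?thesis by (simp add: v')
      qed
    qed
    then have "sum ?g (back_pairs xs) \<le> sum ?g (insert (k, j) (back_pairs ?ys))"
      by (intro sum_mono2) (auto simp: exchange_gain_nonneg)
    also have "\<dots> \<le> ?g (k, j) + sum ?g (back_pairs ?ys)"
      using exchange_gain_nonneg[of n p k j] by (simp add: sum.insert_if)
    finally show ?thesis by simp
  qed
  ultimately show ?case by linarith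
qed

section \<open>Averaging over the position of the back match\<close>

text \<open>
  Given the tail above \<open>k\<close>, only \<open>k\<close> cards are left for position \<open>k\<close>.
\<close>

lemma card_free_cards:
  assumes \<sigma>: "\<sigma> \<in> perms n" and k: "1 \<le> k" "k \<le> n"
  shows "card ((\<lambda>\<tau>. inv \<tau> k) ` {\<tau> \<in> perms n. signed_tail n (k + 1) \<tau> = signed_tail n (k + 1) \<sigma>}) \<le> k"
proof -
  let ?F = "(\<lambda>\<tau>. inv \<tau> k) ` {\<tau> \<in> perms n. signed_tail n (k + 1) \<tau> = signed_tail n (k + 1) \<sigma>}"
  have tail: "set (tail n (k + 1) \<tau>) = inv \<tau> ` {k<..n}" for \<tau>
    unfolding tail_def set_map set_upt by (rule arg_cong[where f = "image (inv \<tau>)"]) auto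
  have "?F \<subseteq> {1..n} - inv \<sigma> ` {k<..n}"
  proof
    fix a assume "a \<in> ?F"
    then obtain \<tau> where \<tau>: "\<tau> \<in> perms n" "signed_tail n (k + 1) \<tau> = signed_tail n (k + 1) \<sigma>"
      "a = inv \<tau> k" by blast
    have p: "inv \<tau> permutes {1..n}" using inv_perms[OF \<tau>(1)] unfolding perms_iff .
    have "k \<in> {1..n}" using k by simp
    then have "a \<in> {1..n}" unfolding \<tau>(3) using p by (simp only: permutes_in_image)
    moreover have "inv \<sigma> ` {k<..n} = inv \<tau> ` {k<..n}"
      using \<tau>(2) tail[of \<sigma>] tail[of \<tau>] by (simp add: signed_tail_def)
    moreover have "a \<notin> inv \<tau> ` {k<..n}"
      unfolding \<tau>(3) inj_image_mem_iff[OF permutes_inj[OF p]] by simp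
    ultimately show "a \<in> {1..n} - inv \<sigma> ` {k<..n}" by simp
  qed
  moreover have "card ({1..n} - inv \<sigma> ` {k<..n}) = k"
  proof -
    have p: "inv \<sigma> permutes {1..n}" using inv_perms[OF \<sigma>] unfolding perms_iff .
    have "inv \<sigma> ` {k<..n} \<subseteq> inv \<sigma> ` {1..n}" by (rule image_mono) auto
    then have "inv \<sigma> ` {k<..n} \<subseteq> {1..n}" unfolding permutes_image[OF p] .
    moreover have "card (inv \<sigma> ` {k<..n}) = n - k"
      by (simp add: card_image inj_on_subset[OF permutes_inj[OF p]])
    ultimately show ?thesis using k(2) by (simp add: card_Diff_subset finite_subset)
  qed
  ultimately show ?thesis using card_mono[of "{1..n} - inv \<sigma> ` {k<..n}" ?F] by simp
qed

text \<open>
  A given card is in at most one of the positions \<open>1, \<dots>, k\<close>.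
\<close>

lemma sum_card_and_tail_le:
  assumes p: "set_pmf p \<subseteq> perms n"
  shows "(\<Sum>j\<in>{1..k}. pmf (map_pmf (card_and_tail n k j) p) v) \<le> pmf (map_pmf (signed_tail n (k + 1)) p) (snd v)"
proof -
  let ?A = "\<lambda>j. {\<sigma> \<in> perms n. card_and_tail n k j \<sigma> = v}"
  have "(\<Sum>j\<in>{1..k}. pmf (map_pmf (card_and_tail n k j) p) v) = (\<Sum>j\<in>{1..k}. measure_pmf.prob p (?A j))"
    unfolding prob_perms[OF p, symmetric] by (simp add: pmf_map vimage_def)
  also have "\<dots> = measure_pmf.prob p (\<Union>j\<in>{1..k}. ?A j)"
  proof (rule measure_pmf.finite_measure_finite_Union[symmetric])
    show "disjoint_family_on ?A {1..k}"
    proof (unfold disjoint_family_on_def, intro ballI impI)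
      fix i j :: nat assume "i \<noteq> j"
      show "?A i \<inter> ?A j = {}"
      proof (rule ccontr)
        assume "?A i \<inter> ?A j \<noteq> {}"
        then obtain \<sigma> where \<sigma>: "\<sigma> \<in> perms n"
          and "card_and_tail n k i \<sigma> = v" "card_and_tail n k j \<sigma> = v" by blast
        then have eq: "inv \<sigma> i = inv \<sigma> j" unfolding card_and_tail_def by (metis prod.inject)
        have "inj (inv \<sigma>)" using inv_perms[OF \<sigma>] unfolding perms_iff by (rule permutes_inj)
        then show False using eq \<open>i \<noteq> j\<close> by (simp add: inj_eq)
      qed
    qed
  qed auto
  also have "\<dots> \<le> measure_pmf.prob p {\<sigma>. signed_tail n (k + 1) \<sigma> = snd v}"
    by (intro measure_pmf.finite_measure_mono) (auto simp: card_and_tail_def)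
  finally show ?thesis by (simp add: pmf_map vimage_def)
qed

text \<open>
  Let \<open>x v\<close> and \<open>y j v\<close> be the joint laws of the signed tail with the cards in positions \<open>k\<close> and \<open>j\<close>, and
  let \<open>w\<close> be the sum of the \<open>y j\<close> over \<open>j \<le> k\<close>. Subadditivity of \<open>js\<close> bounds the average of the gains from
  below by the divergence of \<open>x\<close> from \<open>w / k\<close>, which plays the role of the uniform law given the tail. Since
  \<open>w v\<close> is at most the probability of the tail, and both \<open>x\<close> and \<open>w / k\<close> have total mass \<open>1\<close>, the bound
  \<open>js_ge_entropy_summand\<close> sums up to the conditional entropy of the card in position \<open>k\<close>.
\<close>

lemma averaged_exchange_gain:
  assumes p: "set_pmf p \<subseteq> perms n" and k: "3 \<le> k" "k \<le> n"
  shows "1 / (48 * ln (real n)) * expected_ENT n p (\<lambda>\<sigma>. inv \<sigma> k) (signed_tail n (k + 1)) \<le>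
    (\<Sum>j\<in>{1..k - 1}. exchange_gain n p k j) / real k"
proof -
  let ?V = "cards_and_tails n k"
  define x where "x v = pmf (map_pmf (card_and_tail n k k) p) v" for v
  define y where "y j v = pmf (map_pmf (card_and_tail n k j) p) v" for j v
  define w where "w v = (\<Sum>j\<in>{1..k}. y j v)" for v
  define X where "X \<tau> = pmf (map_pmf (signed_tail n (k + 1)) p) \<tau>" for \<tau>
  have nn: "0 \<le> x v" "0 \<le> y j v" "0 \<le> w v" for v j by (auto simp: x_def y_def w_def intro: sum_nonneg)
  have xw: "x v \<le> w v" for v
    unfolding w_def x_def y_def[symmetric] using k by (intro member_le_sum) (auto simp: nn)
  have wX: "w v \<le> X (snd v)" for v
    using sum_card_and_tail_le[OF p, of k v] by (simp add: w_def y_def X_def)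
  have y1: "(\<Sum>v\<in>?V. y j v) = 1" if "j \<in> {1..k}" for j
    unfolding y_def
  proof (rule sum_pmf_eq_1)
    have "j \<in> {1..n}" using that k by auto
    then show "set_pmf (map_pmf (card_and_tail n k j) p) \<subseteq> ?V"
      using p card_and_tail_in by auto
  qed simp
  have x1: "(\<Sum>v\<in>?V. x v) = 1" using y1[of k] k by (simp add: x_def y_def)
  have w1: "(\<Sum>v\<in>?V. w v) = real k"
    unfolding w_def by (subst sum.swap) (simp add: y1)
  let ?c = "1 / (48 * ln (real n))"
  have c: "?c \<ge> 0" using k by simp
  have V: "(\<lambda>\<sigma>. card_and_tail n k k \<sigma>) ` perms n \<subseteq> ?V"
    using card_and_tail_in[of k n] k by auto

  \<comment> \<open>The number of possible cards is at most \<open>k\<close>, and \<open>w\<close> is at most the probability of the tail.\<close>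
  have "expected_ENT n p (\<lambda>\<sigma>. inv \<sigma> k) (signed_tail n (k + 1)) \<le>
      (\<Sum>\<sigma>\<in>perms n. pmf p \<sigma> * ln (real k * x (card_and_tail n k k \<sigma>) / w (card_and_tail n k k \<sigma>)))"
    unfolding expected_ENT_eq[OF p]
  proof (rule sum_mono)
    fix \<sigma> assume \<sigma>: "\<sigma> \<in> perms n"
    let ?v = "card_and_tail n k k \<sigma>"
    let ?F = "(\<lambda>\<tau>. inv \<tau> k) ` {\<tau> \<in> perms n. signed_tail n (k + 1) \<tau> = signed_tail n (k + 1) \<sigma>}"
    have x: "measure_pmf.prob p {\<tau>. inv \<tau> k = inv \<sigma> k \<and> signed_tail n (k + 1) \<tau> = signed_tail n (k + 1) \<sigma>} = x ?v"
      by (simp add: x_def pmf_map vimage_def card_and_tail_def)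
    have X: "measure_pmf.prob p {\<tau>. signed_tail n (k + 1) \<tau> = signed_tail n (k + 1) \<sigma>} = X (snd ?v)"
      by (simp add: X_def pmf_map vimage_def card_and_tail_def)
    show "pmf p \<sigma> * ln (real (card ?F) *
        (measure_pmf.prob p {\<tau>. inv \<tau> k = inv \<sigma> k \<and> signed_tail n (k + 1) \<tau> = signed_tail n (k + 1) \<sigma>} /
         measure_pmf.prob p {\<tau>. signed_tail n (k + 1) \<tau> = signed_tail n (k + 1) \<sigma>}))
      \<le> pmf p \<sigma> * ln (real k * x ?v / w ?v)"
    proof (cases "pmf p \<sigma> = 0")
      case False
      then have "pmf p \<sigma> > 0" by (simp add: less_le)
      then have xpos: "x ?v > 0" using pmf_le_pmf_map[of p \<sigma> "card_and_tail n k k"] by (simp add: x_def)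
      then have wpos: "w ?v > 0" using xw[of ?v] by linarith
      have "?F \<noteq> {}" using \<sigma> by auto
      then have "card ?F > 0" by (intro card_gt_0_iff[THEN iffD2]) auto
      then have "real (card ?F) > 0" by simp
      have "real (card ?F) * (x ?v / X (snd ?v)) \<le> real k * (x ?v / w ?v)"
      proof (rule mult_mono)
        show "real (card ?F) \<le> real k" using card_free_cards[OF \<sigma> _ k(2)] k(1) by simp
        show "x ?v / X (snd ?v) \<le> x ?v / w ?v"
          using xpos wpos wX[of ?v] by (intro divide_left_mono) auto
      qed (use xpos wpos wX[of ?v] in auto)
      moreover have "0 < real (card ?F) * (x ?v / X (snd ?v))"
        using \<open>real (card ?F) > 0\<close> xpos wpos wX[of ?v] by simp
      ultimately have "ln (real (card ?F) * (x ?v / X (snd ?v))) \<le> ln (real k * (x ?v / w ?v))"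
        by simp
      then show ?thesis unfolding x X by (simp add: mult_left_mono)
    qed simp
  qed
  also have "\<dots> = (\<Sum>v\<in>card_and_tail n k k ` perms n. x v * ln (real k * x v / w v))"
    using sum_perms_function_of[OF p, where g = "card_and_tail n k k" and f = "\<lambda>v. ln (real k * x v / w v)"]
    by (simp add: x_def)
  also have "\<dots> = (\<Sum>v\<in>?V. x v * ln (real k * x v / w v))"
  proof (rule sum.mono_neutral_left)
    have "x v = 0" if "v \<notin> card_and_tail n k k ` perms n" for v
      unfolding x_def using that p by (auto simp flip: set_pmf_eq simp: pmf_eq_0_set_pmf)
    then show "\<forall>v\<in>?V - card_and_tail n k k ` perms n. x v * ln (real k * x v / w v) = 0" by simp
  qed (use V in auto)
  \<comment> \<open>The added terms cancel after summation; they make every single summand nonnegative.\<close>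
  also have "\<dots> = (\<Sum>v\<in>?V. x v * ln (x v / (w v / real k)) - x v + w v / real k)"
    using k by (simp add: sum.distrib sum_subtractf x1 mult.commute flip: sum_divide_distrib) (simp add: w1)
  finally have "?c * expected_ENT n p (\<lambda>\<sigma>. inv \<sigma> k) (signed_tail n (k + 1)) \<le>
      ?c * (\<Sum>v\<in>?V. x v * ln (x v / (w v / real k)) - x v + w v / real k)"
    using c by (rule mult_left_mono)
  also have "\<dots> = (\<Sum>v\<in>?V. ?c * (x v * ln (x v / (w v / real k)) - x v + w v / real k))"
    by (rule sum_distrib_left)
  also have "\<dots> \<le> (\<Sum>v\<in>?V. js (x v) (w v / real k))"
  proof (intro sum_mono js_ge_entropy_summand)
    fix v
    have "w v * real k \<le> w v * real n" using k nn by (intro mult_left_mono) auto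
    then have "w v \<le> real n * (w v / real k)" using k by (simp add: field_simps)
    then show "x v \<le> real n * (w v / real k)" using xw[of v] by linarith
  qed (use k nn in auto)
  also have "\<dots> \<le> (\<Sum>v\<in>?V. \<Sum>j\<in>{1..k}. js (x v) (y j v) / real k)"
  proof (rule sum_mono)
    fix v
    have "js (x v) (w v / real k) = js (\<Sum>j\<in>{1..k}. 1 / real k * x v) (\<Sum>j\<in>{1..k}. 1 / real k * y j v)"
      using k by (simp add: w_def sum_divide_distrib)
    also have "\<dots> \<le> (\<Sum>j\<in>{1..k}. js (1 / real k * x v) (1 / real k * y j v))"
      using k nn by (intro js_sum_le) auto
    also have "\<dots> = (\<Sum>j\<in>{1..k}. js (x v) (y j v) / real k)"
      using k nn by (intro sum.cong refl) (subst js_scale, auto)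
    finally show "js (x v) (w v / real k) \<le> (\<Sum>j\<in>{1..k}. js (x v) (y j v) / real k)" .
  qed
  also have "\<dots> = (\<Sum>j\<in>{1..k}. exchange_gain n p k j) / real k"
    by (subst sum.swap) (simp add: exchange_gain_def x_def y_def sum_divide_distrib)
  also have "(\<Sum>j\<in>{1..k}. exchange_gain n p k j) = (\<Sum>j\<in>{1..k - 1}. exchange_gain n p k j)"
  proof (rule sum.mono_neutral_right)
    have "j = k" if "j \<in> {1..k} - {1..k - 1}" for j using that k by auto
    then show "\<forall>j\<in>{1..k} - {1..k - 1}. exchange_gain n p k j = 0" by fastforce
  qed auto
  finally show ?thesis .
qed

section \<open>Postponing the coins of the matched collisions\<close>

definition match_set :: "(nat \<Rightarrow> triple list \<times> perm) \<Rightarrow> nat \<Rightarrow> nat \<Rightarrow> triple set" where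
  "match_set \<omega> s m = {(x, y, z). matched \<omega> s m x y z}"

definition involved_set :: "(nat \<Rightarrow> triple list \<times> perm) \<Rightarrow> nat \<Rightarrow> nat \<Rightarrow> nat set" where
  "involved_set \<omega> s m = {w. \<exists>m'\<in>{s..m}. involved \<omega> m' w}"

type_synonym state = "perm \<times> triple set \<times> nat set"

definition state_at :: "nat \<Rightarrow> nat \<Rightarrow> (nat \<Rightarrow> triple list \<times> perm) \<Rightarrow> state" where
  "state_at s m \<omega> = (deck \<omega> m, match_set \<omega> s m, involved_set \<omega> s m)"

text \<open>
  How the matched triples and the involved cards are updated by a shuffle with collision triples \<open>xs\<close>,
  where \<open>g\<close> is the deck before (or, which makes no difference, after) the coins are tossed.
\<close>

definition add_matches :: "perm \<Rightarrow> triple list \<Rightarrow> triple set \<Rightarrow> nat set \<Rightarrow> triple set" where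
  "add_matches g xs M S =
     M \<union> {(x, y, z). has_collision xs (g x) (g y) (g z) \<and> x \<notin> S \<and> y \<notin> S \<and> z \<notin> S}"

definition add_involved :: "perm \<Rightarrow> triple list \<Rightarrow> nat set \<Rightarrow> nat set" where
  "add_involved g xs S = S \<union> {w. g w \<in> pts xs}"

lemma deck_upd: "m' \<le> m \<Longrightarrow> deck (fun_upd \<omega> (Suc m) v) m' = deck \<omega> m'"
  by (induction m') auto

lemma collide_upd: "m' \<le> m \<Longrightarrow> collide (fun_upd \<omega> (Suc m) v) m' = collide \<omega> m'"
  by (simp add: collide_def deck_upd fun_eq_iff)

lemma involved_upd: "m' \<le> m \<Longrightarrow> involved (fun_upd \<omega> (Suc m) v) m' = involved \<omega> m'"
  by (simp add: involved_def collide_upd fun_eq_iff)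

lemma collide_iff:
  assumes d: "deck \<omega> m \<in> perms n" and xs: "disjoint_triples (fst (\<omega> m))"
  shows "collide \<omega> m x y z \<longleftrightarrow> has_collision (fst (\<omega> m)) (deck \<omega> m x) (deck \<omega> m y) (deck \<omega> m z)"
proof -
  have bij: "bij (deck \<omega> m)" using d unfolding perms_iff by (rule permutes_bij)
  have inv: "inv (deck \<omega> m) i = w \<longleftrightarrow> i = deck \<omega> m w" for i w
    using bij by (metis bij_inv_eq_iff)
  have "distinct [x, y, z]" if "has_collision (fst (\<omega> m)) (deck \<omega> m x) (deck \<omega> m y) (deck \<omega> m z)"
    using has_collision_distinct[OF xs that] by auto
  then show ?thesis unfolding collide_def inv by blast
qed

lemma involved_iff:
  assumes d: "deck \<omega> m \<in> perms n" and xs: "disjoint_triples (fst (\<omega> m))"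
  shows "involved \<omega> m w \<longleftrightarrow> deck \<omega> m w \<in> pts (fst (\<omega> m))"
proof
  assume "involved \<omega> m w"
  then obtain a b c where *: "collide \<omega> m a b c" "w \<in> {a, b, c}" unfolding involved_def by blast
  then show "deck \<omega> m w \<in> pts (fst (\<omega> m))"
    using has_collision_pts[OF *(1)[unfolded collide_iff[OF d xs]]] by auto
next
  assume "deck \<omega> m w \<in> pts (fst (\<omega> m))"
  then obtain j k where jk: "has_collision (fst (\<omega> m)) (deck \<omega> m w) j k"
    using pts_has_collision by blast
  have bij: "bij (deck \<omega> m)" using d unfolding perms_iff by (rule permutes_bij)
  then obtain y z where "j = deck \<omega> m y" "k = deck \<omega> m z" by (metis bij_pointE)
  then have "collide \<omega> m w y z" using jk unfolding collide_iff[OF d xs] by simp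
  then show "involved \<omega> m w" unfolding involved_def by blast
qed

text \<open>
  The time \<open>T\<^sub>x\<^sub>y\<^sub>z\<close> is the present one exactly if none of \<open>x, y, z\<close> has been involved since time \<open>s\<close> and
  one of them is involved now. So the matched triples and the involved cards, together with the deck, evolve as
  a Markov chain.
\<close>

lemma state_at_Suc:
  assumes s: "s \<le> Suc m" and d: "\<pi> \<circ> deck \<omega> m \<in> perms n" and xs: "disjoint_triples xs"
  shows "state_at s (Suc m) (fun_upd \<omega> (Suc m) (xs, \<pi>)) =
    (\<pi> \<circ> deck \<omega> m, add_matches (\<pi> \<circ> deck \<omega> m) xs (match_set \<omega> s m) (involved_set \<omega> s m),
     add_involved (\<pi> \<circ> deck \<omega> m) xs (involved_set \<omega> s m))"
proof -
  let ?\<omega> = "fun_upd \<omega> (Suc m) (xs, \<pi>)" and ?g = "\<pi> \<circ> deck \<omega> m"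
  have dS: "deck ?\<omega> (Suc m) = ?g" by (simp add: deck_upd)
  have col: "collide ?\<omega> (Suc m) x y z \<longleftrightarrow> has_collision xs (?g x) (?g y) (?g z)" for x y z
    using collide_iff[of ?\<omega> "Suc m" n x y z] d xs unfolding dS by simp
  have inv: "involved ?\<omega> (Suc m) w \<longleftrightarrow> ?g w \<in> pts xs" for w
    using involved_iff[of ?\<omega> "Suc m" n w] d xs unfolding dS by simp
  have "(\<exists>m'\<in>{s..Suc m}. involved ?\<omega> m' w) \<longleftrightarrow> (\<exists>m'\<in>{s..m}. involved \<omega> m' w) \<or> ?g w \<in> pts xs" for w
    using s by (auto simp: atLeastAtMostSuc_conv involved_upd inv[unfolded comp_def])
  then have I: "involved_set ?\<omega> s (Suc m) = add_involved ?g xs (involved_set \<omega> s m)"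
    unfolding involved_set_def add_involved_def by blast
  have ft: "first_time ?\<omega> s (Suc m) x y z m' \<longleftrightarrow> first_time \<omega> s m x y z m'" if "m' \<le> m" for x y z m'
  proof -
    have "(\<forall>i\<in>{s..<m'}. \<forall>w\<in>{x, y, z}. \<not> involved ?\<omega> i w) \<longleftrightarrow> (\<forall>i\<in>{s..<m'}. \<forall>w\<in>{x, y, z}. \<not> involved \<omega> i w)"
      using that by (intro ball_cong refl) (simp add: involved_upd)
    then show ?thesis using that unfolding first_time_def by (simp add: involved_upd)
  qed
  have ft': "first_time ?\<omega> s (Suc m) x y z (Suc m) \<and> collide ?\<omega> (Suc m) x y z \<longleftrightarrow>
      collide ?\<omega> (Suc m) x y z \<and> {x, y, z} \<inter> involved_set \<omega> s m = {}" for x y z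
  proof -
    have "(\<forall>i\<in>{s..<Suc m}. \<forall>w\<in>{x, y, z}. \<not> involved ?\<omega> i w) \<longleftrightarrow>
        (\<forall>i\<in>{s..m}. \<forall>w\<in>{x, y, z}. \<not> involved \<omega> i w)"
      by (intro ball_cong) (auto simp: involved_upd)
    also have "\<dots> \<longleftrightarrow> {x, y, z} \<inter> involved_set \<omega> s m = {}" unfolding involved_set_def by blast
    moreover have "collide ?\<omega> (Suc m) x y z \<Longrightarrow> \<exists>w\<in>{x, y, z}. involved ?\<omega> (Suc m) w"
      unfolding involved_def by blast
    ultimately show ?thesis using s unfolding first_time_def by auto
  qed
  have "matched ?\<omega> s (Suc m) x y z \<longleftrightarrow> matched \<omega> s m x y z \<or>
      collide ?\<omega> (Suc m) x y z \<and> {x, y, z} \<inter> involved_set \<omega> s m = {}" for x y z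
  proof -
    have le: "m' \<le> Suc m" if "first_time ?\<omega> s (Suc m) x y z m'" for m'
      using that unfolding first_time_def by simp
    have le': "m' \<le> m" if "first_time \<omega> s m x y z m'" for m'
      using that unfolding first_time_def by simp
    have "matched ?\<omega> s (Suc m) x y z \<longleftrightarrow>
        (\<exists>m'\<le>m. first_time ?\<omega> s (Suc m) x y z m' \<and> collide ?\<omega> m' x y z) \<or>
        first_time ?\<omega> s (Suc m) x y z (Suc m) \<and> collide ?\<omega> (Suc m) x y z"
      unfolding matched_def using le le_Suc_eq by blast
    also have "(\<exists>m'\<le>m. first_time ?\<omega> s (Suc m) x y z m' \<and> collide ?\<omega> m' x y z) \<longleftrightarrow> matched \<omega> s m x y z"
      unfolding matched_def using ft collide_upd le' by metis
    finally show ?thesis unfolding ft' .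
  qed
  then have "match_set ?\<omega> s (Suc m) = add_matches ?g xs (match_set \<omega> s m) (involved_set \<omega> s m)"
    unfolding match_set_def add_matches_def col by auto
  then show ?thesis unfolding state_at_def I dS by simp
qed

lemma add_matches_collisions:
  assumes "disjoint_triples xs" "\<kappa> \<in> set_pmf (collisions_pmf xs)"
  shows "add_matches (\<kappa> \<circ> g) xs M S = add_matches g xs M S"
  unfolding add_matches_def comp_apply has_collision_collisions[OF assms] ..

lemma add_involved_collisions:
  assumes "\<kappa> \<in> set_pmf (collisions_pmf xs)"
  shows "add_involved (\<kappa> \<circ> g) xs S = add_involved g xs S"
  unfolding add_involved_def comp_apply permutes_in_image[OF collisions_permutes[OF assms]] ..

text \<open>
  New matches involve cards outside \<open>S\<close> only, so they do not depend on the outcome of earlier coins, which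
  permute cards in \<open>S\<close>.
\<close>

lemma add_matches_fixed:
  assumes "\<And>w. w \<notin> S \<Longrightarrow> \<kappa> w = w"
  shows "add_matches (g \<circ> \<kappa>) xs M S = add_matches g xs M S"
proof -
  have "has_collision xs (g (\<kappa> x)) (g (\<kappa> y)) (g (\<kappa> z)) \<and> x \<notin> S \<and> y \<notin> S \<and> z \<notin> S \<longleftrightarrow>
      has_collision xs (g x) (g y) (g z) \<and> x \<notin> S \<and> y \<notin> S \<and> z \<notin> S" for x y z
    using assms[of x] assms[of y] assms[of z] by (cases "x \<in> S"; cases "y \<in> S"; cases "z \<in> S") simp_all
  then show ?thesis unfolding add_matches_def comp_apply by simp
qed

lemma add_involved_fixed:
  assumes "\<And>w. w \<notin> S \<Longrightarrow> \<kappa> w = w"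
  shows "add_involved (g \<circ> \<kappa>) xs S = add_involved g xs S"
proof -
  have "w \<in> S \<or> g (\<kappa> w) \<in> pts xs \<longleftrightarrow> w \<in> S \<or> g w \<in> pts xs" for w
    using assms[of w] by (cases "w \<in> S") simp_all
  then show ?thesis unfolding add_involved_def comp_apply by blast
qed

definition shuffle_step :: "(perm \<times> triple list) pmf \<Rightarrow> state \<Rightarrow> state pmf" where
  "shuffle_step F = (\<lambda>(d, M, S). bind_pmf F (\<lambda>(\<nu>, xs). map_pmf (\<lambda>\<kappa>.
     (\<kappa> \<circ> (\<nu> \<circ> d), add_matches (\<nu> \<circ> d) xs M S, add_involved (\<nu> \<circ> d) xs S)) (collisions_pmf xs)))"

lemma monte3_formD:
  assumes "monte3_form n F" "(\<nu>, xs) \<in> set_pmf F"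
  shows "\<nu> \<in> perms n" "disjoint_triples xs" "pts xs \<subseteq> {1..n}"
  using assms unfolding monte3_form_def perms_iff disjoint_triples_def pts_def by fast+

lemma deck_perms:
  assumes F: "monte3_form n F" and "\<omega> \<in> set_pmf (shuffles_pmf F t)" "m \<le> t"
  shows "deck \<omega> m \<in> perms n"
  using assms(3)
proof (induction m)
  case 0
  then show ?case by (simp only: deck.simps id_perms)
next
  case (Suc m)
  have "\<omega> (Suc m) \<in> set_pmf (monte3_pmf F)"
    using assms(2) Suc.prems unfolding shuffles_pmf_def by (auto simp: set_Pi_pmf PiE_dflt_def)
  then obtain \<nu> xs \<kappa> where *: "(\<nu>, xs) \<in> set_pmf F" "\<kappa> \<in> set_pmf (collisions_pmf xs)"
      "snd (\<omega> (Suc m)) = \<kappa> \<circ> \<nu>"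
    unfolding monte3_pmf_def by auto
  have "\<kappa> \<in> perms n" using collisions_perms[OF monte3_formD(3)[OF F *(1)]] *(2) by blast
  then show ?case
    using monte3_formD(1)[OF F *(1)] Suc *(3) by (simp add: compose_perms del: o_apply)
qed

lemma shuffles_pmf_Suc:
  "shuffles_pmf F (Suc m) =
    bind_pmf (shuffles_pmf F m) (\<lambda>f. bind_pmf F (\<lambda>(\<nu>, xs).
      map_pmf (\<lambda>\<kappa>. fun_upd f (Suc m) (xs, \<kappa> \<circ> \<nu>)) (collisions_pmf xs)))"
proof -
  have "{1..Suc m} = insert (Suc m) {1..m}" by auto
  then have "shuffles_pmf F (Suc m) = bind_pmf (monte3_pmf F) (\<lambda>v. bind_pmf (shuffles_pmf F m)
      (\<lambda>f. return_pmf (fun_upd f (Suc m) v)))"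
    unfolding shuffles_pmf_def by (simp only:) (rule Pi_pmf_insert', auto)
  also have "\<dots> = bind_pmf (shuffles_pmf F m) (\<lambda>f. bind_pmf (monte3_pmf F) (\<lambda>v. return_pmf (fun_upd f (Suc m) v)))"
    by (rule bind_commute_pmf)
  finally show ?thesis
    by (simp add: monte3_pmf_def map_pmf_def bind_assoc_pmf bind_return_pmf case_prod_unfold)
qed

lemma map_state_at_Suc:
  assumes F: "monte3_form n F" and s: "s \<le> Suc m"
  shows "map_pmf (state_at s (Suc m)) (shuffles_pmf F (Suc m)) =
    bind_pmf (map_pmf (state_at s m) (shuffles_pmf F m)) (shuffle_step F)"
  unfolding shuffles_pmf_Suc bind_map_pmf map_bind_pmf[of _ "shuffles_pmf F m"]
proof (rule bind_pmf_cong[OF refl])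
  fix \<omega> assume \<omega>: "\<omega> \<in> set_pmf (shuffles_pmf F m)"
  have d: "deck \<omega> m \<in> perms n" by (rule deck_perms[OF F \<omega>]) simp
  have "map_pmf (state_at s (Suc m)) (case v of (\<nu>, xs) \<Rightarrow>
      map_pmf (\<lambda>\<kappa>. fun_upd \<omega> (Suc m) (xs, \<kappa> \<circ> \<nu>)) (collisions_pmf xs)) =
    (case v of (\<nu>, xs) \<Rightarrow> map_pmf (\<lambda>\<kappa>. (\<kappa> \<circ> (\<nu> \<circ> deck \<omega> m),
      add_matches (\<nu> \<circ> deck \<omega> m) xs (match_set \<omega> s m) (involved_set \<omega> s m),
      add_involved (\<nu> \<circ> deck \<omega> m) xs (involved_set \<omega> s m))) (collisions_pmf xs))"
    if v: "v \<in> set_pmf F" for v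
  proof -
    obtain \<nu> xs where v': "v = (\<nu>, xs)" by (cases v)
    note M = monte3_formD[OF F v[unfolded v']]
    show ?thesis unfolding v' prod.case pmf.map_comp
    proof (intro map_pmf_cong refl)
      fix \<kappa> assume \<kappa>: "\<kappa> \<in> set_pmf (collisions_pmf xs)"
      have \<kappa>n: "\<kappa> \<in> perms n" using collisions_perms[OF M(3)] \<kappa> by blast
      have "\<kappa> \<circ> \<nu> \<circ> deck \<omega> m \<in> perms n" using \<kappa>n M(1) d by (intro compose_perms)
      from state_at_Suc[OF s this M(2)]
      show "(state_at s (Suc m) \<circ> (\<lambda>\<kappa>. fun_upd \<omega> (Suc m) (xs, \<kappa> \<circ> \<nu>))) \<kappa> = (\<kappa> \<circ> (\<nu> \<circ> deck \<omega> m),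
          add_matches (\<nu> \<circ> deck \<omega> m) xs (match_set \<omega> s m) (involved_set \<omega> s m),
          add_involved (\<nu> \<circ> deck \<omega> m) xs (involved_set \<omega> s m))"
        unfolding comp_assoc add_matches_collisions[OF M(2) \<kappa>] add_involved_collisions[OF \<kappa>]
        by (simp only: comp_apply)
    qed
  qed
  then show "map_pmf (state_at s (Suc m)) (bind_pmf F (\<lambda>(\<nu>, xs).
      map_pmf (\<lambda>\<kappa>. fun_upd \<omega> (Suc m) (xs, \<kappa> \<circ> \<nu>)) (collisions_pmf xs))) = shuffle_step F (state_at s m \<omega>)"
    unfolding shuffle_step_def state_at_def prod.case map_bind_pmf by (intro bind_pmf_cong refl)
qed

text \<open>
  A triple \<open>(D, L, S)\<close> describes the same history with the coins of the matched collisions still hidden: \<open>D\<close> is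
  the deck when all these coins show tails, \<open>L\<close> lists the matched triples of cards, and \<open>S\<close> is the set of
  involved cards. A card that has been matched is involved, hence the condition \<open>pts L \<subseteq> S\<close> below.
\<close>

type_synonym postponed = "perm \<times> triple list \<times> nat set"

definition valid_postponed :: "nat \<Rightarrow> postponed \<Rightarrow> bool" where
  "valid_postponed n = (\<lambda>(D, L, S). D \<in> perms n \<and> disjoint_triples L \<and> pts L \<subseteq> {1..n} \<and> pts L \<subseteq> S)"

text \<open>
  Tossing the hidden coins moves cards before \<open>D\<close> is applied, since \<open>L\<close> consists of cards.
\<close>

definition toss :: "postponed \<Rightarrow> state pmf" where
  "toss = (\<lambda>(D, L, S). map_pmf (\<lambda>\<kappa>. (D \<circ> \<kappa>, {(x, y, z). has_collision L x y z}, S)) (collisions_pmf L))"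

lemma pts_filter_all:
  assumes "w \<in> pts (filter (\<lambda>(a, b, c). Q a \<and> Q b \<and> Q c) xs)"
  shows "Q w"
  using pts_has_collision[OF assms] unfolding has_collision_filter by blast

text \<open>
  One shuffle, seen with hidden coins. The collisions are split into the new matches, whose three cards are
  all outside \<open>S\<close>, and the others. The coins of the others are tossed at once and enter \<open>D\<close>. The new
  matches are performed first and then moved from positions to cards, that is past the deck \<open>g\<close>, where they join
  the hidden ones. The updates of the matches and of \<open>S\<close> do not depend on the hidden coins, because these
  permute \<open>S\<close> and fix all other cards.
\<close>

lemma postponed_step:
  assumes q: "valid_postponed n (D, L, S)" and \<nu>: "\<nu> \<in> perms n"
    and xs: "disjoint_triples xs" "pts xs \<subseteq> {1..n}"
  obtains Q where "\<And>q. q \<in> set_pmf Q \<Longrightarrow> valid_postponed n q"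
    "bind_pmf (toss (D, L, S)) (\<lambda>(d, M, S). map_pmf (\<lambda>\<kappa>.
       (\<kappa> \<circ> (\<nu> \<circ> d), add_matches (\<nu> \<circ> d) xs M S, add_involved (\<nu> \<circ> d) xs S)) (collisions_pmf xs))
     = bind_pmf Q toss"
proof
  have D: "D \<in> perms n" and L: "disjoint_triples L" "pts L \<subseteq> {1..n}" "pts L \<subseteq> S"
    using q by (auto simp: valid_postponed_def)
  define g where "g = \<nu> \<circ> D"
  have g: "g \<in> perms n" unfolding g_def by (rule compose_perms[OF \<nu> D])
  have bg: "bij g" using g unfolding perms_iff by (rule permutes_bij)
  have big: "bij (inv g)" by (rule bij_imp_bij_inv[OF bg])
  have ig: "inv g (g x) = x" "g (inv g x) = x" for x
    using bg by (simp_all add: bij_is_inj bij_is_surj surj_f_inv_f)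
  let ?fresh = "\<lambda>(a, b, c). inv g a \<notin> S \<and> inv g b \<notin> S \<and> inv g c \<notin> S"
  let ?new = "filter ?fresh xs" and ?old = "filter (\<lambda>t. \<not> ?fresh t) xs"
  let ?N = "map (map_triple (inv g)) ?new"
  let ?S = "add_involved g xs S"
  let ?M = "{(x, y, z). has_collision (L @ ?N) x y z}"
  let ?Q = "map_pmf (\<lambda>\<rho>. (\<rho> \<circ> g, L @ ?N, ?S)) (collisions_pmf ?old)"
  have new_notin: "inv g w \<notin> S" if "w \<in> pts ?new" for w
    using pts_filter_all[of w "\<lambda>a. inv g a \<notin> S" xs] that .
  have new_pts: "w \<in> pts xs" if "w \<in> pts ?new" for w using pts_filter that by blast
  show "valid_postponed n q'" if "q' \<in> set_pmf ?Q" for q'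
  proof -
    obtain \<rho> where \<rho>: "\<rho> \<in> set_pmf (collisions_pmf ?old)" "q' = (\<rho> \<circ> g, L @ ?N, ?S)"
      using \<open>q' \<in> set_pmf ?Q\<close> by auto
    have "pts ?old \<subseteq> {1..n}" using pts_filter xs(2) by (rule subset_trans)
    then have "\<rho> \<in> perms n" using collisions_perms \<rho>(1) by blast
    then have 1: "\<rho> \<circ> g \<in> perms n" using g by (rule compose_perms)
    have "disjoint_triples ?N"
      by (rule disjoint_triples_map[OF disjoint_triples_filter[OF xs(1)] bij_is_inj[OF big]])
    moreover have "pts L \<inter> pts ?N = {}" using L(3) new_notin unfolding pts_map by blast
    ultimately have 2: "disjoint_triples (L @ ?N)" using L(1) by simp
    have "inv g permutes {1..n}" using inv_perms[OF g] unfolding perms_iff .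
    then have "inv g w \<in> {1..n}" if "w \<in> pts ?new" for w
      using new_pts[OF that] xs(2) by (simp only: permutes_in_image) blast
    then have "pts ?N \<subseteq> {1..n}" unfolding pts_map by blast
    then have 3: "pts (L @ ?N) \<subseteq> {1..n}" using L(2) by simp
    have "pts ?N \<subseteq> ?S" unfolding pts_map add_involved_def using new_pts ig(2) by auto
    then have 4: "pts (L @ ?N) \<subseteq> ?S" using L(3) by (auto simp: add_involved_def)
    show ?thesis unfolding valid_postponed_def \<rho>(2) prod.case using 1 2 3 4 by blast
  qed
  have M: "add_matches g xs {(x, y, z). has_collision L x y z} S = ?M"
    unfolding add_matches_def has_collision_append has_collision_map[OF bg] has_collision_filter ig
    by blast
  have fixed: "\<eta> w = w" if "\<eta> \<in> set_pmf (collisions_pmf L)" "w \<notin> S" for \<eta> w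
    using permutes_not_in[OF collisions_permutes[OF that(1)]] that(2) L(3) by blast
  have "bind_pmf (toss (D, L, S)) (\<lambda>(d, M, S). map_pmf (\<lambda>\<kappa>.
       (\<kappa> \<circ> (\<nu> \<circ> d), add_matches (\<nu> \<circ> d) xs M S, add_involved (\<nu> \<circ> d) xs S)) (collisions_pmf xs))
     = bind_pmf (collisions_pmf L) (\<lambda>\<eta>. map_pmf (\<lambda>\<kappa>. (\<kappa> \<circ> g \<circ> \<eta>, ?M, ?S)) (collisions_pmf xs))"
    unfolding toss_def prod.case bind_map_pmf
  proof (intro bind_pmf_cong map_pmf_cong refl)
    fix \<eta> \<kappa> assume \<eta>: "\<eta> \<in> set_pmf (collisions_pmf L)"
    have "\<nu> \<circ> (D \<circ> \<eta>) = g \<circ> \<eta>" by (simp add: g_def comp_assoc)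
    moreover have "add_matches (g \<circ> \<eta>) xs M' S = add_matches g xs M' S" for M'
      by (rule add_matches_fixed) (rule fixed[OF \<eta>])
    moreover have "add_involved (g \<circ> \<eta>) xs S = ?S"
      by (rule add_involved_fixed) (rule fixed[OF \<eta>])
    ultimately show "(\<kappa> \<circ> (\<nu> \<circ> (D \<circ> \<eta>)), add_matches (\<nu> \<circ> (D \<circ> \<eta>)) xs {(x, y, z). has_collision L x y z} S,
        add_involved (\<nu> \<circ> (D \<circ> \<eta>)) xs S) = (\<kappa> \<circ> g \<circ> \<eta>, ?M, ?S)"
      by (simp only: M comp_assoc)
  qed
  also have "\<dots> = map_pmf (\<lambda>d. (d, ?M, ?S)) (conv (collisions_pmf L) (conv (return_pmf g) (collisions_pmf xs)))"
    by (simp add: conv_eq_bind map_pmf_def bind_assoc_pmf bind_return_pmf)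
  also have "conv (return_pmf g) (collisions_pmf xs) =
      conv (collisions_pmf ?N) (conv (return_pmf g) (collisions_pmf ?old))"
  proof -
    have "conv (return_pmf g) (collisions_pmf ?new) = conv (collisions_pmf ?N) (return_pmf g)"
    proof -
      have "collisions_pmf ?N = map_pmf (\<lambda>\<kappa>. inv g \<circ> \<kappa> \<circ> inv (inv g)) (collisions_pmf ?new)"
        by (rule collisions_pmf_conjugate[OF disjoint_triples_filter[OF xs(1)] big])
      moreover have "g \<circ> (inv g \<circ> \<kappa> \<circ> inv (inv g)) = \<kappa> \<circ> g" for \<kappa>
        by (simp add: inv_inv_eq[OF bg] fun_eq_iff ig)
      ultimately show ?thesis
        by (simp add: conv_eq_bind map_pmf_def bind_assoc_pmf bind_return_pmf)
    qed
    then show ?thesis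
      using collisions_pmf_partition[OF xs(1), of ?fresh] by (simp only: conv_assoc[symmetric])
  qed
  also have "conv (collisions_pmf L) (conv (collisions_pmf ?N) (conv (return_pmf g) (collisions_pmf ?old)))
      = conv (collisions_pmf (L @ ?N)) (conv (return_pmf g) (collisions_pmf ?old))"
    by (simp only: collisions_pmf_append conv_assoc)
  also have "map_pmf (\<lambda>d. (d, ?M, ?S)) \<dots> = bind_pmf ?Q toss"
  proof -
    have "map_pmf (\<lambda>d. (d, ?M, ?S)) (conv (collisions_pmf (L @ ?N)) (conv (return_pmf g) (collisions_pmf ?old)))
      = bind_pmf (collisions_pmf (L @ ?N)) (\<lambda>\<eta>. bind_pmf (collisions_pmf ?old) (\<lambda>\<rho>. return_pmf (\<rho> \<circ> g \<circ> \<eta>, ?M, ?S)))"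
      by (simp add: conv_eq_bind map_pmf_def bind_assoc_pmf bind_return_pmf)
    also have "\<dots> = bind_pmf (collisions_pmf ?old) (\<lambda>\<rho>. bind_pmf (collisions_pmf (L @ ?N)) (\<lambda>\<eta>. return_pmf (\<rho> \<circ> g \<circ> \<eta>, ?M, ?S)))"
      by (rule bind_commute_pmf)
    also have "\<dots> = bind_pmf ?Q toss"
      by (simp add: toss_def map_pmf_def bind_assoc_pmf bind_return_pmf)
    finally show ?thesis .
  qed
  finally show "bind_pmf (toss (D, L, S)) (\<lambda>(d, M, S). map_pmf (\<lambda>\<kappa>.
       (\<kappa> \<circ> (\<nu> \<circ> d), add_matches (\<nu> \<circ> d) xs M S, add_involved (\<nu> \<circ> d) xs S)) (collisions_pmf xs))
     = bind_pmf ?Q toss" .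
qed

text \<open>
  The start of the observation is written as \<open>Suc s\<close>, so that at time \<open>s\<close> there are no matches and no
  involved cards yet, and \<open>D\<close> is the deck itself.
\<close>

lemma postponed_exists:
  assumes F: "monte3_form n F" and m: "m \<ge> s"
  shows "\<exists>Q. (\<forall>q\<in>set_pmf Q. valid_postponed n q) \<and>
    map_pmf (state_at (Suc s) m) (shuffles_pmf F m) = bind_pmf Q toss"
  using m
proof (induction m rule: dec_induct)
  case base
  let ?Q = "map_pmf (\<lambda>\<omega>. (deck \<omega> s, [], {})) (shuffles_pmf F s)"
  have "state_at (Suc s) s \<omega> = (deck \<omega> s, {}, {})" for \<omega>
    by (auto simp: state_at_def match_set_def involved_set_def matched_def first_time_def)
  moreover have "toss (D, [], {}) = return_pmf (D, {}, {})" for D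
  proof -
    have "{(x, y, z). has_collision [] x y z} = {}" by simp
    then show ?thesis unfolding toss_def prod.case by (simp only: collisions_pmf.simps map_return_pmf comp_id)
  qed
  ultimately have "map_pmf (state_at (Suc s) s) (shuffles_pmf F s) = bind_pmf ?Q toss"
    by (simp add: map_pmf_def bind_assoc_pmf bind_return_pmf)
  moreover have "valid_postponed n q" if "q \<in> set_pmf ?Q" for q
    using that deck_perms[OF F _ order_refl] by (auto simp: valid_postponed_def)
  ultimately show ?case by blast
next
  case (step m)
  then obtain Q where Q: "\<And>q. q \<in> set_pmf Q \<Longrightarrow> valid_postponed n q"
    "map_pmf (state_at (Suc s) m) (shuffles_pmf F m) = bind_pmf Q toss" by blast
  let ?step = "\<lambda>q v. bind_pmf (toss q) (\<lambda>(d, M, S). map_pmf (\<lambda>\<kappa>.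
       (\<kappa> \<circ> (fst v \<circ> d), add_matches (fst v \<circ> d) (snd v) M S, add_involved (fst v \<circ> d) (snd v) S))
       (collisions_pmf (snd v)))"
  have "\<exists>R. (\<forall>r\<in>set_pmf R. valid_postponed n r) \<and> ?step q v = bind_pmf R toss"
    if q: "q \<in> set_pmf Q" and v: "v \<in> set_pmf F" for q v
  proof -
    obtain D L S where q': "q = (D, L, S)" by (cases q)
    obtain \<nu> xs where v': "v = (\<nu>, xs)" by (cases v)
    note M = monte3_formD[OF F v[unfolded v']]
    obtain R where "\<And>r. r \<in> set_pmf R \<Longrightarrow> valid_postponed n r" "?step q v = bind_pmf R toss"
      using postponed_step[OF Q(1)[OF q, unfolded q'] M] unfolding q' v' fst_conv snd_conv by blast
    then show ?thesis by blast
  qed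
  note ex = this
  define R where "R q v = (SOME R. (\<forall>r\<in>set_pmf R. valid_postponed n r) \<and> ?step q v = bind_pmf R toss)"
    for q v
  have R: "(\<forall>r\<in>set_pmf (R q v). valid_postponed n r) \<and> ?step q v = bind_pmf (R q v) toss"
    if "q \<in> set_pmf Q" "v \<in> set_pmf F" for q v
    unfolding R_def by (rule someI_ex[OF ex[OF that]])
  let ?Q = "bind_pmf Q (\<lambda>q. bind_pmf F (R q))"
  have "map_pmf (state_at (Suc s) (Suc m)) (shuffles_pmf F (Suc m)) =
      bind_pmf (bind_pmf Q toss) (shuffle_step F)"
    unfolding Q(2)[symmetric] using step.hyps by (intro map_state_at_Suc[OF F]) linarith
  also have "\<dots> = bind_pmf Q (\<lambda>q. bind_pmf (toss q) (\<lambda>\<sigma>. bind_pmf F (\<lambda>v. case \<sigma> of (d, M, S) \<Rightarrow>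
      map_pmf (\<lambda>\<kappa>. (\<kappa> \<circ> (fst v \<circ> d), add_matches (fst v \<circ> d) (snd v) M S,
        add_involved (fst v \<circ> d) (snd v) S)) (collisions_pmf (snd v)))))"
    by (simp add: bind_assoc_pmf shuffle_step_def case_prod_unfold)
  also have "\<dots> = bind_pmf Q (\<lambda>q. bind_pmf F (\<lambda>v. ?step q v))"
    by (subst bind_commute_pmf) (rule refl)
  also have "\<dots> = bind_pmf Q (\<lambda>q. bind_pmf F (\<lambda>v. bind_pmf (R q v) toss))"
    by (intro bind_pmf_cong refl R[THEN conjunct2])
  also have "\<dots> = bind_pmf ?Q toss" by (simp add: bind_assoc_pmf)
  finally have "map_pmf (state_at (Suc s) (Suc m)) (shuffles_pmf F (Suc m)) = bind_pmf ?Q toss" .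
  moreover have "valid_postponed n r" if "r \<in> set_pmf ?Q" for r
    using that R[THEN conjunct1] by (simp only: set_bind_pmf UN_iff) blast
  ultimately show ?case by blast
qed

section \<open>The entropy bound\<close>

text \<open>
  A matched set consists of the rotations of disjoint triples; this makes the matches of a card unique.
\<close>

lemma match_set_eq:
  assumes F: "monte3_form n F" and s: "s \<in> {1..t}" and \<omega>: "\<omega> \<in> set_pmf (shuffles_pmf F t)"
  obtains L where "disjoint_triples L" "match_set \<omega> s t = {(x, y, z). has_collision L x y z}"
proof -
  obtain s' where s': "s = Suc s'" "s' \<le> t" using s by (cases s) auto
  obtain Q where Q: "\<forall>q\<in>set_pmf Q. valid_postponed n q"
    "map_pmf (state_at s t) (shuffles_pmf F t) = bind_pmf Q toss"
    using postponed_exists[OF F s'(2)] unfolding s'(1) by blast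
  have "state_at s t \<omega> \<in> set_pmf (map_pmf (state_at s t) (shuffles_pmf F t))" using \<omega> by simp
  then obtain q where q: "q \<in> set_pmf Q" "state_at s t \<omega> \<in> set_pmf (toss q)"
    unfolding Q(2) by auto
  obtain D L S where q': "q = (D, L, S)" by (cases q)
  have "disjoint_triples L" using bspec[OF Q(1) q(1)] unfolding q' valid_postponed_def prod.case by blast
  moreover have "match_set \<omega> s t = {(x, y, z). has_collision L x y z}"
  proof -
    obtain \<kappa> where "state_at s t \<omega> = (D \<circ> \<kappa>, {(x, y, z). has_collision L x y z}, S)"
      using q(2) unfolding q' toss_def prod.case set_map_pmf by (rule imageE)
    then show ?thesis unfolding state_at_def by (simp only: prod.inject)
  qed
  ultimately show ?thesis by (rule that)
qed

lemma back_match_imp_match: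
  assumes F: "monte3_form n F" and s: "s \<in> {1..t}" and \<omega>: "\<omega> \<in> set_pmf (shuffles_pmf F t)"
    and b: "back_match \<omega> s t k = j" "front_match \<omega> s t k < k" "j < k"
  shows "\<exists>y<k. (k, y, j) \<in> match_set \<omega> s t"
proof -
  obtain L where L: "disjoint_triples L" "match_set \<omega> s t = {(x, y, z). has_collision L x y z}"
    by (rule match_set_eq[OF F s \<omega>])
  have m: "matched \<omega> s t x y z \<longleftrightarrow> has_collision L x y z" for x y z
    using L(2) unfolding match_set_def by blast
  have ex: "\<exists>y z. matched \<omega> s t k y z"
  proof (rule ccontr)
    assume "\<not> (\<exists>y z. matched \<omega> s t k y z)"
    then have "back_match \<omega> s t k = k" unfolding back_match_def by (rule if_not_P)
    then show False using b by simp
  qed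
  then obtain y z where yz: "matched \<omega> s t k y z" by blast
  have uniq: "y' = y \<and> z' = z" if "matched \<omega> s t k y' z'" for y' z'
    by (rule has_collision_unique[OF L(1) that[unfolded m] yz[unfolded m]])
  have "(THE z. \<exists>y. matched \<omega> s t k y z) = z"
  proof (rule the_equality)
    show "\<exists>y. matched \<omega> s t k y z" using yz by (rule exI)
    fix z' assume "\<exists>y. matched \<omega> s t k y z'"
    then obtain y' where "matched \<omega> s t k y' z'" by (rule exE)
    then show "z' = z" by (rule uniq[THEN conjunct2])
  qed
  then have "back_match \<omega> s t k = z" unfolding back_match_def if_P[OF ex] .
  then have "z = j" using b(1) by simp
  have "(THE y. \<exists>z. matched \<omega> s t k y z) = y"
  proof (rule the_equality)
    show "\<exists>z. matched \<omega> s t k y z" using yz by (rule exI)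
    fix y' assume "\<exists>z. matched \<omega> s t k y' z"
    then obtain z' where "matched \<omega> s t k y' z'" by (rule exE)
    then show "y' = y" by (rule uniq[THEN conjunct1])
  qed
  then have "front_match \<omega> s t k = y" unfolding front_match_def if_P[OF ex] .
  then have "y < k" using b(2) by simp
  moreover have "(k, y, j) \<in> match_set \<omega> s t"
    using yz unfolding \<open>z = j\<close> match_set_def by simp
  ultimately show ?thesis by (intro exI conjI)
qed

text \<open>
  The component \<open>S\<close> is left out because this leaves finitely many possibilities, so that mixtures over
  them are finite sums.
\<close>

definition postponed_pairs :: "nat \<Rightarrow> (perm \<times> triple list) set" where
  "postponed_pairs n = perms n \<times> {L. disjoint_triples L \<and> pts L \<subseteq> {1..n}}"

lemma finite_postponed_pairs: "finite (postponed_pairs n)"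
proof -
  have len: "length L \<le> card (pts L)" if "disjoint_triples L" for L
    using that
  proof (induction L)
    case (Cons t L)
    obtain a b c where t: "t = (a, b, c)" by (cases t)
    have "card (pts (t # L)) = card {a, b, c} + card (pts L)"
      unfolding t pts_simps by (rule card_Un_disjoint) (use Cons.prems in \<open>simp_all add: t\<close>)
    moreover have "card {a, b, c} = 3" using Cons.prems by (simp add: t)
    moreover have "length L \<le> card (pts L)" using Cons by (simp add: t)
    ultimately show ?case by simp
  qed simp
  have "length L \<le> n" if "disjoint_triples L" "pts L \<subseteq> {1..n}" for L
    using len[OF that(1)] card_mono[OF _ that(2)] by simp
  moreover have "set L \<subseteq> {1..n} \<times> {1..n} \<times> {1..n}" if "pts L \<subseteq> {1..n}" for L
  proof
    fix t assume t: "t \<in> set L"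
    obtain a b c where t': "t = (a, b, c)" by (cases t)
    have "has_collision L a b c" using t unfolding t' has_collision_def by blast
    then show "t \<in> {1..n} \<times> {1..n} \<times> {1..n}"
      using has_collision_pts[of L a b c] that unfolding t' by blast
  qed
  ultimately have "{L. disjoint_triples L \<and> pts L \<subseteq> {1..n}} \<subseteq>
      {L. set L \<subseteq> {1..n} \<times> {1..n} \<times> {1..n} \<and> length L \<le> n}" by blast
  moreover have "finite {L. set L \<subseteq> {1..n} \<times> {1..n} \<times> {1..n} \<and> length L \<le> n}"
    by (intro finite_lists_length_le) simp
  ultimately show ?thesis unfolding postponed_pairs_def by (intro finite_cartesian_product finite_perms) (rule finite_subset)
qed

text \<open>
  The law of the deck as a mixture over the postponed data, averaged also over \<open>T\<close>. Under the same mixing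
  law the matches are \<open>back_pairs\<close> of the hidden triples.
\<close>

lemma postponed_representation:
  assumes F: "monte3_form n F" and T: "set_pmf \<T> \<subseteq> {1..t}"
  obtains R where "set_pmf R \<subseteq> postponed_pairs n"
    "map_pmf (\<lambda>\<omega>. deck \<omega> t) (shuffles_pmf F t) =
       bind_pmf R (\<lambda>(D, L). map_pmf (\<lambda>\<kappa>. D \<circ> \<kappa>) (collisions_pmf L))"
    "\<And>k j. j < k \<Longrightarrow> measure_pmf.prob (pair_pmf \<T> (shuffles_pmf F t))
       {(s, \<omega>). back_match \<omega> s t k = j \<and> front_match \<omega> s t k < k} \<le>
     measure_pmf.prob R {(D, L). (k, j) \<in> back_pairs L}"
proof -
  have ex: "\<exists>Q. (\<forall>q\<in>set_pmf Q. valid_postponed n q) \<and>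
      map_pmf (state_at s t) (shuffles_pmf F t) = bind_pmf Q toss" if s: "s \<in> set_pmf \<T>" for s
  proof -
    obtain s' where "s = Suc s'" "s' \<le> t" using s T by (cases s) auto
    then show ?thesis using postponed_exists[OF F] by blast
  qed
  define Q where "Q s = (SOME Q. (\<forall>q\<in>set_pmf Q. valid_postponed n q) \<and>
    map_pmf (state_at s t) (shuffles_pmf F t) = bind_pmf Q toss)" for s
  have Q: "(\<forall>q\<in>set_pmf (Q s). valid_postponed n q) \<and>
    map_pmf (state_at s t) (shuffles_pmf F t) = bind_pmf (Q s) toss" if "s \<in> set_pmf \<T>" for s
    unfolding Q_def by (rule someI_ex[OF ex[OF that]])
  define Q' where "Q' = bind_pmf \<T> Q"
  define R where "R = map_pmf (\<lambda>(D, L, S). (D, L)) Q'"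
  have law: "bind_pmf \<T> (\<lambda>s. map_pmf (state_at s t) (shuffles_pmf F t)) = bind_pmf Q' toss"
    unfolding Q'_def bind_assoc_pmf by (intro bind_pmf_cong refl) (use Q in blast)
  show ?thesis
  proof (rule that)
    have "valid_postponed n q" if "q \<in> set_pmf Q'" for q
      using that Q unfolding Q'_def set_bind_pmf by blast
    then have "(\<lambda>(D, L, S). (D, L)) q \<in> postponed_pairs n" if "q \<in> set_pmf Q'" for q
      using that unfolding postponed_pairs_def valid_postponed_def
      by (cases q) (simp only: prod.case mem_Times_iff fst_conv snd_conv mem_Collect_eq, blast)
    then show "set_pmf R \<subseteq> postponed_pairs n" unfolding R_def set_map_pmf by blast
  next
    have "map_pmf (\<lambda>\<omega>. deck \<omega> t) (shuffles_pmf F t) =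
        bind_pmf \<T> (\<lambda>s. map_pmf fst (map_pmf (state_at s t) (shuffles_pmf F t)))"
      by (simp add: pmf.map_comp state_at_def comp_def)
    also have "\<dots> = map_pmf fst (bind_pmf Q' toss)" unfolding law[symmetric] map_bind_pmf ..
    also have "\<dots> = bind_pmf R (\<lambda>(D, L). map_pmf (\<lambda>\<kappa>. D \<circ> \<kappa>) (collisions_pmf L))"
      unfolding R_def bind_map_pmf map_bind_pmf
      by (intro bind_pmf_cong refl) (auto simp: toss_def pmf.map_comp intro!: map_pmf_cong)
    finally show "map_pmf (\<lambda>\<omega>. deck \<omega> t) (shuffles_pmf F t) =
        bind_pmf R (\<lambda>(D, L). map_pmf (\<lambda>\<kappa>. D \<circ> \<kappa>) (collisions_pmf L))" .
  next
    fix k j :: nat assume j: "j < k"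
    define E where "E = {M. \<exists>y<k. (k, y, j) \<in> (M :: triple set)}"
    let ?P = "pair_pmf \<T> (shuffles_pmf F t)"
    let ?B = "{(s, \<omega>). back_match \<omega> s t k = j \<and> front_match \<omega> s t k < k}"
    have "measure_pmf.prob ?P ?B = measure_pmf.prob ?P (?B \<inter> set_pmf ?P)"
      by (rule measure_Int_set_pmf[symmetric])
    also have "\<dots> \<le> measure_pmf.prob ?P {(s, \<omega>). match_set \<omega> s t \<in> E}"
    proof (rule measure_pmf.finite_measure_mono)
      show "?B \<inter> set_pmf ?P \<subseteq> {(s, \<omega>). match_set \<omega> s t \<in> E}"
      proof
        fix v assume v: "v \<in> ?B \<inter> set_pmf ?P"
        obtain s \<omega> where v': "v = (s, \<omega>)" by (cases v)
        have "s \<in> {1..t}" "\<omega> \<in> set_pmf (shuffles_pmf F t)" using v T unfolding v' by auto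
        moreover have "back_match \<omega> s t k = j" "front_match \<omega> s t k < k" using v unfolding v' by auto
        ultimately show "v \<in> {(s, \<omega>). match_set \<omega> s t \<in> E}"
          using back_match_imp_match[OF F _ _ _ _ j] unfolding v' E_def by blast
      qed
    qed simp
    also have "\<dots> = measure_pmf.prob (map_pmf (\<lambda>(s, \<omega>). match_set \<omega> s t) ?P) E"
      by (simp add: vimage_def case_prod_unfold)
    also have "map_pmf (\<lambda>(s, \<omega>). match_set \<omega> s t) ?P =
        map_pmf (\<lambda>x. fst (snd x)) (bind_pmf \<T> (\<lambda>s. map_pmf (state_at s t) (shuffles_pmf F t)))"
      by (simp add: pair_pmf_def map_pmf_def bind_assoc_pmf bind_return_pmf state_at_def)
    also have "\<dots> = bind_pmf Q' (\<lambda>q. map_pmf (\<lambda>x. fst (snd x)) (toss q))"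
      unfolding law map_bind_pmf ..
    also have "\<dots> = bind_pmf Q' (\<lambda>q. return_pmf (case q of (D, L, S) \<Rightarrow> {(x, y, z). has_collision L x y z}))"
    proof (rule bind_pmf_cong[OF refl])
      fix q :: postponed
      obtain D L S where q: "q = (D, L, S)" by (cases q)
      show "map_pmf (\<lambda>x. fst (snd x)) (toss q) =
          return_pmf (case q of (D, L, S) \<Rightarrow> {(x, y, z). has_collision L x y z})"
        unfolding q toss_def prod.case pmf.map_comp comp_def fst_conv snd_conv by (rule map_pmf_const)
    qed
    also have "\<dots> = map_pmf (\<lambda>(D, L). {(x, y, z). has_collision L x y z}) R"
      by (simp add: R_def map_pmf_def bind_assoc_pmf bind_return_pmf case_prod_unfold)
    also have "measure_pmf.prob \<dots> E = measure_pmf.prob R {(D, L). (k, j) \<in> back_pairs L}"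
      unfolding measure_map_pmf
    proof (intro arg_cong[where f = "measure_pmf.prob R"] set_eqI)
      fix r :: "perm \<times> triple list"
      obtain D L where r: "r = (D, L)" by (cases r)
      show "r \<in> (\<lambda>(D, L). {(x, y, z). has_collision L x y z}) -` E \<longleftrightarrow> r \<in> {(D, L). (k, j) \<in> back_pairs L}"
        unfolding r E_def back_pairs_def vimage_def mem_Collect_eq prod.case using j by blast
    qed
    finally show "measure_pmf.prob ?P ?B \<le> measure_pmf.prob R {(D, L). (k, j) \<in> back_pairs L}" .
  qed
qed

lemma prob_eq_sum_set_pmf:
  assumes "finite (set_pmf R)"
  shows "measure_pmf.prob R A = (\<Sum>r\<in>set_pmf R. if r \<in> A then pmf R r else 0)"
proof -
  have "measure_pmf.prob R A = measure_pmf.prob R (set_pmf R \<inter> A)"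
    unfolding Int_commute[of "set_pmf R"] by (rule measure_Int_set_pmf[symmetric])
  also have "\<dots> = (\<Sum>r\<in>set_pmf R. if r \<in> A then pmf R r else 0)"
    using assms unfolding measure_measure_pmf_finite[OF finite_Int[OF disjI1[OF assms]]]
    by (rule sum.inter_restrict)
  finally show ?thesis .
qed

theorem theorem4p1:
  "\<exists>C::real. C > 0 \<and>
     (\<forall>(n::nat) (t::nat) (F :: (perm \<times> triple list) pmf) (\<T> :: nat pmf) (A :: nat \<Rightarrow> real)
        (\<mu> :: perm pmf).
        n \<ge> 3 \<longrightarrow> monte3_form n F \<longrightarrow> t > 0 \<longrightarrow> set_pmf \<T> \<subseteq> {1..t} \<longrightarrow>
        (\<forall>k\<in>{3..n}. 0 \<le> A k \<and> A k \<le> 1 \<and>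
           (\<forall>j\<in>{1..k - 1}.
              measure_pmf.prob (pair_pmf \<T> (shuffles_pmf F t))
                {(s, \<omega>). back_match \<omega> s t k = j \<and> front_match \<omega> s t k < k} \<ge> A k / real k)) \<longrightarrow>
        set_pmf \<mu> \<subseteq> {\<sigma>. \<sigma> permutes {1..n}} \<longrightarrow>
        expected_ENT n (map_pmf (\<lambda>(\<sigma>, \<omega>). deck \<omega> t \<circ> \<sigma>) (pair_pmf \<mu> (shuffles_pmf F t))) id sign
          - expected_ENT n \<mu> id sign
        \<le> - C / ln (real n) *
            (\<Sum>k=3..n. A k * expected_ENT n \<mu> (\<lambda>\<sigma>. inv \<sigma> k) (signed_tail n (k + 1))))"
proof (intro exI[of _ "1 / 48"] conjI allI impI)
  \<comment> \<open>The constant of \<open>js_ge_entropy_summand\<close>.\<close>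
  show "(0::real) < 1 / 48" by simp
next
  fix n t :: nat and F :: "(perm \<times> triple list) pmf" and \<T> :: "nat pmf"
    and A :: "nat \<Rightarrow> real" and \<mu> :: "perm pmf"
  assume F: "monte3_form n F" and T: "set_pmf \<T> \<subseteq> {1..t}"
    and A: "\<forall>k\<in>{3..n}. 0 \<le> A k \<and> A k \<le> 1 \<and>
           (\<forall>j\<in>{1..k - 1}.
              measure_pmf.prob (pair_pmf \<T> (shuffles_pmf F t))
                {(s, \<omega>). back_match \<omega> s t k = j \<and> front_match \<omega> s t k < k} \<ge> A k / real k)"
    and \<mu>: "set_pmf \<mu> \<subseteq> {\<sigma>. \<sigma> permutes {1..n}}"
  have p: "set_pmf \<mu> \<subseteq> perms n" using \<mu> unfolding perms_def .
  let ?G = "\<lambda>p. expected_ENT n p id sign"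
  let ?g = "\<lambda>(k, j). exchange_gain n \<mu> k j"
  let ?E = "\<lambda>k. expected_ENT n \<mu> (\<lambda>\<sigma>. inv \<sigma> k) (signed_tail n (k + 1))"
  obtain R where R: "set_pmf R \<subseteq> postponed_pairs n"
    and law: "map_pmf (\<lambda>\<omega>. deck \<omega> t) (shuffles_pmf F t) =
       bind_pmf R (\<lambda>(D, L). map_pmf (\<lambda>\<kappa>. D \<circ> \<kappa>) (collisions_pmf L))"
    and prob: "\<And>k j. j < k \<Longrightarrow> measure_pmf.prob (pair_pmf \<T> (shuffles_pmf F t))
       {(s, \<omega>). back_match \<omega> s t k = j \<and> front_match \<omega> s t k < k} \<le>
     measure_pmf.prob R {(D, L). (k, j) \<in> back_pairs L}"
    by (rule postponed_representation[OF F T]) blast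
  have finR: "finite (set_pmf R)" using R finite_postponed_pairs by (rule finite_subset)
  have "fst r \<in> perms n \<and> disjoint_triples (snd r) \<and> pts (snd r) \<subseteq> {1..n}" if "r \<in> set_pmf R" for r
    using subsetD[OF R that] unfolding postponed_pairs_def mem_Times_iff mem_Collect_eq .
  then have Rv: "fst r \<in> perms n" "disjoint_triples (snd r)" "pts (snd r) \<subseteq> {1..n}"
    if "r \<in> set_pmf R" for r using that by blast+

  let ?K = "\<lambda>r. map_pmf (\<lambda>\<sigma>. fst r \<circ> \<sigma>) (conv \<mu> (collisions_pmf (snd r)))"
  have "map_pmf (\<lambda>(\<sigma>, \<omega>). deck \<omega> t \<circ> \<sigma>) (pair_pmf \<mu> (shuffles_pmf F t)) =
      conv \<mu> (map_pmf (\<lambda>\<omega>. deck \<omega> t) (shuffles_pmf F t))"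
    by (simp add: conv_eq_bind pair_pmf_def map_pmf_def bind_assoc_pmf bind_return_pmf)
  also have "\<dots> = bind_pmf \<mu> (\<lambda>\<sigma>. bind_pmf R (\<lambda>r. map_pmf (\<lambda>\<kappa>. fst r \<circ> \<kappa> \<circ> \<sigma>) (collisions_pmf (snd r))))"
    unfolding law by (simp add: conv_eq_bind map_pmf_def bind_assoc_pmf bind_return_pmf case_prod_unfold)
  also have "\<dots> = bind_pmf R (\<lambda>r. bind_pmf \<mu> (\<lambda>\<sigma>. map_pmf (\<lambda>\<kappa>. fst r \<circ> \<kappa> \<circ> \<sigma>) (collisions_pmf (snd r))))"
    by (rule bind_commute_pmf)
  also have "\<dots> = bind_pmf R ?K"
    by (simp add: conv_eq_bind map_pmf_def bind_assoc_pmf bind_return_pmf comp_assoc)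
  finally have shuffled: "map_pmf (\<lambda>(\<sigma>, \<omega>). deck \<omega> t \<circ> \<sigma>) (pair_pmf \<mu> (shuffles_pmf F t)) = bind_pmf R ?K" .

  have conv: "set_pmf (conv \<mu> (collisions_pmf (snd r))) \<subseteq> perms n" if "r \<in> set_pmf R" for r
    by (rule conv_perms[OF p collisions_perms[OF Rv(3)[OF that]]])
  have "set_pmf (?K r) \<subseteq> perms n" if "r \<in> set_pmf R" for r
    using conv[OF that] compose_perms[OF Rv(1)[OF that]] unfolding set_map_pmf by blast
  then have "?G (bind_pmf R ?K) \<le> (\<Sum>r\<in>set_pmf R. pmf R r * ?G (?K r))"
    by (rule expected_ENT_mixture[OF finR])
  also have "\<dots> \<le> (\<Sum>r\<in>set_pmf R. pmf R r * (?G \<mu> - sum ?g (back_pairs (snd r))))"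
  proof (intro sum_mono mult_left_mono)
    fix r assume r: "r \<in> set_pmf R"
    show "?G (?K r) \<le> ?G \<mu> - sum ?g (back_pairs (snd r))"
      unfolding expected_ENT_compose_perm[OF Rv(1)[OF r] conv[OF r]]
      by (rule expected_ENT_collisions[OF p Rv(2)[OF r] Rv(3)[OF r]])
  qed simp
  also have "\<dots> = ?G \<mu> - (\<Sum>r\<in>set_pmf R. pmf R r * sum ?g (back_pairs (snd r)))"
    by (simp add: right_diff_distrib sum_subtractf sum_pmf_eq_1[OF finR] flip: sum_distrib_right)
  finally have "?G (bind_pmf R ?K) - ?G \<mu> \<le> - (\<Sum>r\<in>set_pmf R. pmf R r * sum ?g (back_pairs (snd r)))"
    by simp
  moreover have "1 / 48 / ln (real n) * (\<Sum>k=3..n. A k * ?E k) \<le>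
      (\<Sum>r\<in>set_pmf R. pmf R r * sum ?g (back_pairs (snd r)))"
  proof -
    let ?I = "SIGMA k:{3..n}. {1..k - 1}"
    have "1 / 48 / ln (real n) * (\<Sum>k=3..n. A k * ?E k) = (\<Sum>k=3..n. A k * (1 / (48 * ln (real n)) * ?E k))"
      by (simp add: sum_distrib_left mult_ac)
    also have "\<dots> \<le> (\<Sum>k=3..n. A k * ((\<Sum>j\<in>{1..k - 1}. exchange_gain n \<mu> k j) / real k))"
      using A by (intro sum_mono mult_left_mono averaged_exchange_gain[OF p]) auto
    also have "\<dots> = (\<Sum>k=3..n. \<Sum>j\<in>{1..k - 1}. A k / real k * exchange_gain n \<mu> k j)"
      by (simp add: sum_distrib_left sum_divide_distrib)
    also have "\<dots> \<le> (\<Sum>k=3..n. \<Sum>j\<in>{1..k - 1}.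
        measure_pmf.prob R {(D, L). (k, j) \<in> back_pairs L} * exchange_gain n \<mu> k j)"
    proof (intro sum_mono mult_right_mono exchange_gain_nonneg)
      fix k j assume k: "k \<in> {3..n}" and j: "j \<in> {1..k - 1}"
      have "A k / real k \<le> measure_pmf.prob (pair_pmf \<T> (shuffles_pmf F t))
          {(s, \<omega>). back_match \<omega> s t k = j \<and> front_match \<omega> s t k < k}" using A k j by blast
      also have "\<dots> \<le> measure_pmf.prob R {(D, L). (k, j) \<in> back_pairs L}"
        by (rule prob) (use k j in auto)
      finally show "A k / real k \<le> measure_pmf.prob R {(D, L). (k, j) \<in> back_pairs L}" .
    qed
    also have "\<dots> = (\<Sum>v\<in>?I. measure_pmf.prob R {r. v \<in> back_pairs (snd r)} * ?g v)"
      by (subst sum.Sigma) (auto simp: case_prod_unfold)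
    also have "\<dots> = (\<Sum>v\<in>?I. \<Sum>r\<in>set_pmf R. pmf R r * (if v \<in> back_pairs (snd r) then ?g v else 0))"
      unfolding prob_eq_sum_set_pmf[OF finR] sum_distrib_right by (intro sum.cong refl) simp
    also have "\<dots> = (\<Sum>r\<in>set_pmf R. pmf R r * (\<Sum>v\<in>?I. if v \<in> back_pairs (snd r) then ?g v else 0))"
      by (subst sum.swap) (simp add: sum_distrib_left)
    also have "\<dots> \<le> (\<Sum>r\<in>set_pmf R. pmf R r * sum ?g (back_pairs (snd r)))"
    proof (intro sum_mono mult_left_mono)
      fix r
      have "(\<Sum>v\<in>?I. if v \<in> back_pairs (snd r) then ?g v else 0) = sum ?g (?I \<inter> back_pairs (snd r))"
        by (rule sum.inter_restrict[symmetric]) simp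
      also have "\<dots> \<le> sum ?g (back_pairs (snd r))"
        by (intro sum_mono2) (auto simp: exchange_gain_nonneg)
      finally show "(\<Sum>v\<in>?I. if v \<in> back_pairs (snd r) then ?g v else 0) \<le> sum ?g (back_pairs (snd r))" .
    qed simp
    finally show ?thesis .
  qed
  ultimately show "?G (map_pmf (\<lambda>(\<sigma>, \<omega>). deck \<omega> t \<circ> \<sigma>) (pair_pmf \<mu> (shuffles_pmf F t))) - ?G \<mu>
        \<le> - (1 / 48) / ln (real n) * (\<Sum>k=3..n. A k * ?E k)"
    unfolding shuffled by simp
qed

end
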